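(* Let $\boldsymbol{Q}\subset\mathbb{R}^d$ with interfaces $(\Gamma_k)_{k\in\mathbb{N}}$ and constants $(C_k)_{k\in\mathbb{N}}$ be a multiscale interface network, let $\mathfrak{c}>0$, and let $\mathcal{H}=\mathcal{H}_{\mathfrak{c}}$ be the associated fractal space with scalar product $\langle\cdot,\cdot\rangle$. Let $v_{\mathcal{H}}=(v_K)_{K\in\mathbb{N}}$, $w_{\mathcal{H}}=(w_K)_{K\in\mathbb{N}}\in\mathcal{H}$, and let $v,w\in\bigcap_{0<s<\frac12}H^s(\boldsymbol{Q})$ be the associated functions, characterized by $\|v-v_K\|_{H^s(\boldsymbol{Q})}\to0$ and $\|w-w_K\|_{H^s(\boldsymbol{Q})}\to0$ as $K\to\infty$ for all $s\in(0,\frac12)$. Then, with $\nabla v,\nabla w$ the weak gradients and $[\![v]\!],[\![w]\!]$ the generalized jumps, $$\langle v_{\mathcal{H}},w_{\mathcal{H}}\rangle=\int_{\boldsymbol{Q}\setminus\Gamma}\nabla v\cdot\nabla w\,dx+\sum_{k=1}^\infty(1+\mathfrak{c})^kC_k\int_{\Gamma_k}[\![v]\!][\![w]\!]\,d\Gamma_k.$$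
   Context: **Multiscale interface network.** $\boldsymbol{Q}\subset\mathbb{R}^d$ is a bounded domain with Lipschitz boundary containing mutually disjoint interfaces $\Gamma_k$, $k\in\mathbb{N}$, each piecewise affine with finite $(d-1)$-dimensional Hausdorff measure. Put $\Gamma=\bigcup_{k=1}^\infty\Gamma_k$ and $\Gamma^{(K)}=\bigcup_{k=1}^K\Gamma_k$. For each $K\in\mathbb{N}$, $\boldsymbol{Q}\setminus\Gamma^{(K)}=\bigcup_{G\in\mathcal{G}^{(K)}}G$ splits into mutually disjoint, open, simply connected cells $G$ with $\partial G=\partial\overline G$. Let $\mathcal{G}^{(K)}_\infty=\{G\in\mathcal{G}^{(K)}: G\in\mathcal{G}^{(L)}\ \forall L>K\}$ and $d_K=\max\{\operatorname{diam}G: G\in\mathcal{G}^{(K)}\setminus\mathcal{G}^{(K)}_\infty\}$; it is assumed that $d_K\to0$ as $K\to\infty$. With $(x,y)=\{x+s(y-x): s\in(0,1)\}$, it is assumed that $\#\big((x,y)\cap\Gamma_k\big)\le C_k$ for almost all $x,y\in\boldsymbol{Q}$, with $C_k\in\mathbb{N}$ depending only on $k$. **Level-$K$ spaces.** $\mathcal{C}^1_{K,0}(\boldsymbol{Q})$ is the space of $v:\overline{\boldsymbol{Q}}\setminus\Gamma^{(K)}\to\mathbb{R}$ with $v|_G\in C^1(\overline G)$ for all $G\in\mathcal{G}^{(K)}$ and $v|_{\partial\boldsymbol{Q}}\equiv0$. At almost every $\xi\in\Gamma_k$ there is a unit normal $\nu_\xi$, oriented so that $\nu_\xi\cdot e_m>0$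 where $m=\min\{i:\nu_\xi\cdot e_i\ne0\}$ ($e_1,\dots,e_d$ the canonical basis). The normal jump is $[\![v]\!](\xi)=\lim_{s\downarrow0}\big(v(\xi+s\nu_\xi)-v(\xi-s\nu_\xi)\big)$. For $\mathfrak{c}>0$ set $$\langle v,w\rangle_{K,\mathfrak{c}}=\int_{\boldsymbol{Q}\setminus\Gamma^{(K)}}\nabla v\cdot\nabla w\,dx+\sum_{k=1}^K(1+\mathfrak{c})^kC_k\int_{\Gamma_k}[\![v]\!][\![w]\!]\,d\Gamma_k,\qquad \|v\|_{K,\mathfrak{c}}=\langle v,v\rangle_{K,\mathfrak{c}}^{1/2},$$ and let $\mathcal{H}_K$ be the closure (completion) of $\mathcal{C}^1_{K,0}(\boldsymbol{Q})$ in $\|\cdot\|_{K,\mathfrak{c}}$ (gradients and jumps extend by continuity). Then $\mathcal{H}_1\subset\mathcal{H}_2\subset\cdots$ with isometric embeddings. **Fractal space.** $\mathcal{H}^\circ=\bigcup_K\mathcal{H}_K$ carries the scalar product $\langle v,w\rangle_{\mathfrak{c}}=\langle v,w\rangle_{\max\{K,L\},\mathfrak{c}}$ for $v\in\mathcal{H}_L$, $w\in\mathcal{H}_K$. $\mathcal{H}=\mathcal{H}_{\mathfrak{c}}$ is the completion of $\mathcal{H}^\circ$, i.e. the set of equivalence classes of Cauchy sequences; each class is represented by a sequence $(v_K)_{K\in\mathbb{N}}$ with $v_K\in\mathcal{H}_K$. It is a Hilbert space with $\langle (v_K)_K,(w_K)_K\rangle=\lim_{K\to\infty}\langle v_K,w_K\rangle_{K,\mathfrak{c}}$.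 The space $\mathcal{H}$ embeds continuously into $H^s(\boldsymbol{Q})$ for each $s\in(0,\frac12)$ (Sobolev–Slobodeckij norm), so that each $(v_K)_K\in\mathcal{H}$ has a unique associated $v\in\bigcap_{0<s<\frac12}H^s(\boldsymbol{Q})$ with $\|v-v_K\|_{H^s(\boldsymbol{Q})}\to0$ for all such $s$. **Weak gradient and generalized jump.** For $(v_K)_K\in\mathcal{H}$ with associated $v$: $\nabla v=\lim_K\nabla v_K$ in $L^2(\boldsymbol{Q}\setminus\Gamma)^d$ and $[\![v]\!]=\lim_K[\![v_K]\!]$ in the space of sequences $(j_k)_k$, $j_k\in L^2(\Gamma_k)$, with norm $\big(\sum_k(1+\mathfrak{c})^kC_k\|j_k\|_{L^2(\Gamma_k)}^2\big)^{1/2}$ (both limits exist). *)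

theory Defs
  imports "HOL-Analysis.Analysis"
begin

section \<open>Hausdorff measure, square-integrable functions, Sobolev--Slobodeckij norm\<close>

text \<open>The factor \<open>unit_ball_vol n / 2 ^ n\<close> makes the \<open>n\<close>-dimensional Hausdorff measure agree with the
  \<open>n\<close>-dimensional surface measure on affine pieces. The empty set has to be weighted separately
  because of \<open>0 ^ 0 = 1\<close>.\<close>

definition hausdorff_delta :: "nat \<Rightarrow> real \<Rightarrow> 'a::euclidean_space set \<Rightarrow> ennreal" where
  "hausdorff_delta n \<delta> A =
     (INF E \<in> {E :: nat \<Rightarrow> 'a set. A \<subseteq> (\<Union>i. E i) \<and> (\<forall>i. bounded (E i) \<and> diameter (E i) \<le> \<delta>)}.
        \<Sum>i. if E i = {} then 0 else ennreal (unit_ball_vol (real n) * (diameter (E i) / 2) ^ n))"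

definition hausdorff_outer :: "nat \<Rightarrow> 'a::euclidean_space set \<Rightarrow> ennreal" where
  "hausdorff_outer n A = (SUP \<delta> \<in> {0<..}. hausdorff_delta n \<delta> A)"

text \<open>Hausdorff outer measure is a metric outer measure, hence countably additive on Borel sets;
  so \<open>measure_of\<close> keeps its values there.\<close>

definition hausdorff_measure :: "nat \<Rightarrow> 'a::euclidean_space measure" where
  "hausdorff_measure n = measure_of UNIV (sets borel) (hausdorff_outer n)"

text \<open>The measure is completed because normals and jumps are only determined almost everywhere.\<close>

definition surface_measure :: "'a::euclidean_space set \<Rightarrow> 'a measure" where
  "surface_measure S = completion (restrict_space (hausdorff_measure (DIM('a) - 1)) S)"

definition L2_space :: "'a measure \<Rightarrow> ('a \<Rightarrow> 'b::euclidean_space) set" where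
  "L2_space M = {f \<in> borel_measurable M. integrable M (\<lambda>x. (norm (f x))\<^sup>2)}"

definition L2_norm :: "'a measure \<Rightarrow> ('a \<Rightarrow> 'b::euclidean_space) \<Rightarrow> real" where
  "L2_norm M f = sqrt (\<integral>x. (norm (f x))\<^sup>2 \<partial>M)"

definition sobolev_norm_sq :: "real \<Rightarrow> 'a::euclidean_space set \<Rightarrow> ('a \<Rightarrow> real) \<Rightarrow> ennreal" where
  "sobolev_norm_sq s Q u =
     (\<integral>\<^sup>+x. ennreal ((u x)\<^sup>2) \<partial>lebesgue_on Q) +
     (\<integral>\<^sup>+x. (\<integral>\<^sup>+y. ennreal ((u x - u y)\<^sup>2 / dist x y powr (real DIM('a) + 2 * s))
        \<partial>lebesgue_on Q) \<partial>lebesgue_on Q)"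

definition sobolev_space :: "real \<Rightarrow> 'a::euclidean_space set \<Rightarrow> ('a \<Rightarrow> real) set" where
  "sobolev_space s Q = {u \<in> borel_measurable (lebesgue_on Q). sobolev_norm_sq s Q u < \<infinity>}"

section \<open>Completion of a space with a pseudometric\<close>

definition cauchy_seqs :: "'b set \<Rightarrow> ('b \<Rightarrow> 'b \<Rightarrow> real) \<Rightarrow> (nat \<Rightarrow> 'b) set" where
  "cauchy_seqs V d =
     {f. (\<forall>n. f n \<in> V) \<and> (\<forall>\<epsilon>>0. \<exists>N. \<forall>m\<ge>N. \<forall>n\<ge>N. d (f m) (f n) < \<epsilon>)}"

definition cauchy_completion :: "'b set \<Rightarrow> ('b \<Rightarrow> 'b \<Rightarrow> real) \<Rightarrow> (nat \<Rightarrow> 'b) set set" where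
  "cauchy_completion V d =
     cauchy_seqs V d // {(f, g). f \<in> cauchy_seqs V d \<and> g \<in> cauchy_seqs V d \<and>
                                 (\<lambda>n. d (f n) (g n)) \<longlonglongrightarrow> 0}"

text \<open>Extension by continuity of a real-valued form (scalar product or distance) to equivalence
  classes of Cauchy sequences.\<close>

definition extend_form :: "('b \<Rightarrow> 'b \<Rightarrow> real) \<Rightarrow> (nat \<Rightarrow> 'b) set \<Rightarrow> (nat \<Rightarrow> 'b) set \<Rightarrow> real" where
  "extend_form B X Y = lim (\<lambda>n. B ((SOME f. f \<in> X) n) ((SOME g. g \<in> Y) n))"

section \<open>Multiscale interface networks\<close>

text \<open>\<open>real ^ 'n\<close>, for an ordered index type \<open>'n\<close>; the order of the coordinates is used to orient
  the normals.\<close>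

type_synonym 'n vector = "(real, 'n) vec"

text \<open>Near each boundary point \<open>Q\<close> is, in suitably rotated coordinates with vertical direction
  \<open>e\<close>, the strict epigraph of a Lipschitz function on the hyperplane orthogonal to \<open>e\<close>.\<close>

definition lipschitz_boundary :: "'a::euclidean_space set \<Rightarrow> bool" where
  "lipschitz_boundary Q \<longleftrightarrow>
     (\<forall>x\<in>frontier Q. \<exists>e r L \<phi>. norm e = 1 \<and> r > 0 \<and> L-lipschitz_on {z. z \<bullet> e = 0} (\<phi> :: 'a \<Rightarrow> real) \<and>
        Q \<inter> ball x r = {y \<in> ball x r. y \<bullet> e > \<phi> (y - (y \<bullet> e) *\<^sub>R e)})"

text \<open>\<open>\<nu>\<close> is the unit normal at \<open>\<xi>\<close> of a set which is a hyperplane near \<open>\<xi>\<close>; of the two choices, the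
  one whose first nonvanishing coordinate is positive.\<close>

definition is_oriented_normal ::
    "'n::{finite,linorder} vector set \<Rightarrow> 'n vector \<Rightarrow> 'n vector \<Rightarrow> bool" where
  "is_oriented_normal S \<xi> \<nu> \<longleftrightarrow>
     norm \<nu> = 1 \<and> \<nu> $ Min {i. \<nu> $ i \<noteq> 0} > 0 \<and>
     (\<exists>\<epsilon>>0. S \<inter> ball \<xi> \<epsilon> = {x \<in> ball \<xi> \<epsilon>. (x - \<xi>) \<bullet> \<nu> = 0})"

definition oriented_normal :: "'n::{finite,linorder} vector set \<Rightarrow> 'n vector \<Rightarrow> 'n vector" where
  "oriented_normal S \<xi> = (THE \<nu>. is_oriented_normal S \<xi> \<nu>)"

text \<open>The set is not required to be closed: an interface that ends on another one omits the
  common points, since the interfaces are disjoint.\<close>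

definition piecewise_affine :: "'n::{finite,linorder} vector set \<Rightarrow> bool" where
  "piecewise_affine S \<longleftrightarrow>
     (\<exists>F. finite F \<and> (\<forall>H\<in>F. affine H \<and> aff_dim H = int CARD('n) - 1) \<and> S \<subseteq> \<Union>F) \<and>
     (AE \<xi> in surface_measure S. \<exists>\<nu>. is_oriented_normal S \<xi> \<nu>)"

definition interfaces_upto :: "(nat \<Rightarrow> 'a set) \<Rightarrow> nat \<Rightarrow> 'a set" where
  "interfaces_upto \<Gamma> K = (\<Union>k\<in>{1..K}. \<Gamma> k)"

definition all_interfaces :: "(nat \<Rightarrow> 'a set) \<Rightarrow> 'a set" where
  "all_interfaces \<Gamma> = (\<Union>k\<in>{1..}. \<Gamma> k)"

text \<open>A partition of \<open>Q - interfaces_upto \<Gamma> K\<close> into disjoint nonempty open connected sets is necessarily the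
  family of its connected components.\<close>

definition cells :: "'a::topological_space set \<Rightarrow> (nat \<Rightarrow> 'a set) \<Rightarrow> nat \<Rightarrow> 'a set set" where
  "cells Q \<Gamma> K = components (Q - interfaces_upto \<Gamma> K)"

definition permanent_cells :: "'a::topological_space set \<Rightarrow> (nat \<Rightarrow> 'a set) \<Rightarrow> nat \<Rightarrow> 'a set set" where
  "permanent_cells Q \<Gamma> K = {G \<in> cells Q \<Gamma> K. \<forall>L>K. G \<in> cells Q \<Gamma> L}"

text \<open>Inserting \<open>0\<close> only matters if all cells are permanent.\<close>

definition max_cell_diameter :: "'a::metric_space set \<Rightarrow> (nat \<Rightarrow> 'a set) \<Rightarrow> nat \<Rightarrow> real" where
  "max_cell_diameter Q \<Gamma> K =
     Sup (insert 0 (diameter ` (cells Q \<Gamma> K - permanent_cells Q \<Gamma> K)))"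

definition multiscale_network ::
    "'n::{finite,linorder} vector set \<Rightarrow> (nat \<Rightarrow> 'n vector set) \<Rightarrow> (nat \<Rightarrow> nat) \<Rightarrow> bool" where
  "multiscale_network Q \<Gamma> C \<longleftrightarrow>
     open Q \<and> connected Q \<and> Q \<noteq> {} \<and> bounded Q \<and> lipschitz_boundary Q \<and>
     (\<forall>k\<ge>1. \<Gamma> k \<subseteq> Q \<and> piecewise_affine (\<Gamma> k) \<and> emeasure (surface_measure (\<Gamma> k)) (\<Gamma> k) < \<infinity>) \<and>
     disjoint_family_on \<Gamma> {1..} \<and>
     (\<forall>K\<ge>1. \<forall>G\<in>cells Q \<Gamma> K. open G \<and> simply_connected G \<and> frontier G = frontier (closure G)) \<and>
     max_cell_diameter Q \<Gamma> \<longlonglongrightarrow> 0 \<and>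
     (\<forall>k\<ge>1. AE (x, y) in lborel. x \<in> Q \<and> y \<in> Q \<longrightarrow>
        finite (open_segment x y \<inter> \<Gamma> k) \<and> card (open_segment x y \<inter> \<Gamma> k) \<le> C k)"

section \<open>Level-\<open>K\<close> spaces\<close>

definition grad :: "('a::euclidean_space \<Rightarrow> real) \<Rightarrow> 'a \<Rightarrow> 'a" where
  "grad f x = (THE D. GDERIV f x :> D)"

definition jump_quotient ::
    "('n::{finite,linorder} vector \<Rightarrow> real) \<Rightarrow> 'n vector set \<Rightarrow> 'n vector \<Rightarrow> real \<Rightarrow> real" where
  "jump_quotient v S \<xi> s = v (\<xi> + s *\<^sub>R oriented_normal S \<xi>) - v (\<xi> - s *\<^sub>R oriented_normal S \<xi>)"

definition jump :: "('n::{finite,linorder} vector \<Rightarrow> real) \<Rightarrow> 'n vector set \<Rightarrow> 'n vector \<Rightarrow> real" where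
  "jump v S \<xi> = Lim (at_right 0) (jump_quotient v S \<xi>)"

text \<open>Functions on \<open>closure Q - interfaces_upto \<Gamma> K\<close> are modelled by total functions whose values elsewhere are
  irrelevant. Membership of \<open>v\<close> in \<open>C\<^sup>1(closure G)\<close> means that \<open>v\<close> and its gradient extend
  continuously from \<open>G\<close> to \<open>closure G\<close>; the extension of \<open>v\<close> is the given \<open>v\<close> wherever \<open>v\<close> is
  defined, so that the boundary values are attained continuously. The last two lines say that
  the norm of level \<open>K\<close> is well defined and finite.\<close>

definition C1_space ::
    "'n::{finite,linorder} vector set \<Rightarrow> (nat \<Rightarrow> 'n vector set) \<Rightarrow> nat \<Rightarrow> ('n vector \<Rightarrow> real) set" where
  "C1_space Q \<Gamma> K = {v.
     (\<forall>G\<in>cells Q \<Gamma> K.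
        (\<exists>V. continuous_on (closure G) V \<and> (\<forall>x\<in>closure G - interfaces_upto \<Gamma> K. V x = v x)) \<and>
        (\<exists>D. continuous_on (closure G) D \<and> (\<forall>x\<in>G. GDERIV v x :> D x))) \<and>
     (\<forall>x\<in>frontier Q - interfaces_upto \<Gamma> K. v x = 0) \<and>
     grad v \<in> L2_space (lebesgue_on (Q - interfaces_upto \<Gamma> K)) \<and>
     (\<forall>k\<in>{1..K}. (AE \<xi> in surface_measure (\<Gamma> k). \<exists>l. (jump_quotient v (\<Gamma> k) \<xi> \<longlongrightarrow> l) (at_right 0)) \<and>
                 jump v (\<Gamma> k) \<in> L2_space (surface_measure (\<Gamma> k)))}"

definition C1_inner ::
    "'n::{finite,linorder} vector set \<Rightarrow> (nat \<Rightarrow> 'n vector set) \<Rightarrow> (nat \<Rightarrow> nat) \<Rightarrow> real \<Rightarrow> nat \<Rightarrow>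
     ('n vector \<Rightarrow> real) \<Rightarrow> ('n vector \<Rightarrow> real) \<Rightarrow> real" where
  "C1_inner Q \<Gamma> C c K v w =
     (\<integral>x. grad v x \<bullet> grad w x \<partial>lebesgue_on (Q - interfaces_upto \<Gamma> K)) +
     (\<Sum>k=1..K. (1 + c) ^ k * real (C k) *
        (\<integral>\<xi>. jump v (\<Gamma> k) \<xi> * jump w (\<Gamma> k) \<xi> \<partial>surface_measure (\<Gamma> k)))"

definition C1_dist ::
    "'n::{finite,linorder} vector set \<Rightarrow> (nat \<Rightarrow> 'n vector set) \<Rightarrow> (nat \<Rightarrow> nat) \<Rightarrow> real \<Rightarrow> nat \<Rightarrow>
     ('n vector \<Rightarrow> real) \<Rightarrow> ('n vector \<Rightarrow> real) \<Rightarrow> real" where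
  "C1_dist Q \<Gamma> C c K v w =
     sqrt (C1_inner Q \<Gamma> C c K (\<lambda>x. v x - w x) (\<lambda>x. v x - w x))"

type_synonym 'n level_elem = "(nat \<Rightarrow> 'n vector \<Rightarrow> real) set"

definition level_space ::
    "'n::{finite,linorder} vector set \<Rightarrow> (nat \<Rightarrow> 'n vector set) \<Rightarrow> (nat \<Rightarrow> nat) \<Rightarrow> real \<Rightarrow> nat \<Rightarrow>
     'n level_elem set" where
  "level_space Q \<Gamma> C c K = cauchy_completion (C1_space Q \<Gamma> K) (C1_dist Q \<Gamma> C c K)"

text \<open>The following forms of level \<open>M\<close> are also applied to classes of levels \<open>K \<le> M\<close>. This is the
  isometric embedding of level \<open>K\<close> into level \<open>M\<close>: since functions of \<open>C1_space Q \<Gamma> K\<close> are smooth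
  across \<open>\<Gamma> k\<close> for \<open>k > K\<close>, they belong to \<open>C1_space Q \<Gamma> M\<close> with the same norm.\<close>

definition level_inner ::
    "'n::{finite,linorder} vector set \<Rightarrow> (nat \<Rightarrow> 'n vector set) \<Rightarrow> (nat \<Rightarrow> nat) \<Rightarrow> real \<Rightarrow> nat \<Rightarrow>
     'n level_elem \<Rightarrow> 'n level_elem \<Rightarrow> real" where
  "level_inner Q \<Gamma> C c M = extend_form (C1_inner Q \<Gamma> C c M)"

definition level_dist ::
    "'n::{finite,linorder} vector set \<Rightarrow> (nat \<Rightarrow> 'n vector set) \<Rightarrow> (nat \<Rightarrow> nat) \<Rightarrow> real \<Rightarrow> nat \<Rightarrow>
     'n level_elem \<Rightarrow> 'n level_elem \<Rightarrow> real" where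
  "level_dist Q \<Gamma> C c M = extend_form (C1_dist Q \<Gamma> C c M)"

section \<open>The fractal space\<close>

text \<open>The union of the level spaces is formed as a disjoint union: an element is a level together
  with an element of that level. An element and its image in a higher level have distance \<open>0\<close>
  and are identified in the completion.\<close>

definition union_space ::
    "'n::{finite,linorder} vector set \<Rightarrow> (nat \<Rightarrow> 'n vector set) \<Rightarrow> (nat \<Rightarrow> nat) \<Rightarrow> real \<Rightarrow>
     (nat \<times> 'n level_elem) set" where
  "union_space Q \<Gamma> C c = {(K, X). K \<ge> 1 \<and> X \<in> level_space Q \<Gamma> C c K}"

definition union_inner ::
    "'n::{finite,linorder} vector set \<Rightarrow> (nat \<Rightarrow> 'n vector set) \<Rightarrow> (nat \<Rightarrow> nat) \<Rightarrow> real \<Rightarrow>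
     nat \<times> 'n level_elem \<Rightarrow> nat \<times> 'n level_elem \<Rightarrow> real" where
  "union_inner Q \<Gamma> C c = (\<lambda>(L, X) (K, Y). level_inner Q \<Gamma> C c (max K L) X Y)"

definition union_dist ::
    "'n::{finite,linorder} vector set \<Rightarrow> (nat \<Rightarrow> 'n vector set) \<Rightarrow> (nat \<Rightarrow> nat) \<Rightarrow> real \<Rightarrow>
     nat \<times> 'n level_elem \<Rightarrow> nat \<times> 'n level_elem \<Rightarrow> real" where
  "union_dist Q \<Gamma> C c = (\<lambda>(L, X) (K, Y). level_dist Q \<Gamma> C c (max K L) X Y)"

type_synonym 'n fractal_elem = "(nat \<Rightarrow> nat \<times> 'n level_elem) set"

definition fractal_space ::
    "'n::{finite,linorder} vector set \<Rightarrow> (nat \<Rightarrow> 'n vector set) \<Rightarrow> (nat \<Rightarrow> nat) \<Rightarrow> real \<Rightarrow>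
     'n fractal_elem set" where
  "fractal_space Q \<Gamma> C c = cauchy_completion (union_space Q \<Gamma> C c) (union_dist Q \<Gamma> C c)"

definition fractal_inner ::
    "'n::{finite,linorder} vector set \<Rightarrow> (nat \<Rightarrow> 'n vector set) \<Rightarrow> (nat \<Rightarrow> nat) \<Rightarrow> real \<Rightarrow>
     'n fractal_elem \<Rightarrow> 'n fractal_elem \<Rightarrow> real" where
  "fractal_inner Q \<Gamma> C c = extend_form (union_inner Q \<Gamma> C c)"

text \<open>The class \<open>X\<close> is represented by the sequence \<open>v 1, v 2, ...\<close> with \<open>v K\<close> of level \<open>K\<close>;
  \<open>v 0\<close> is irrelevant, here and below.\<close>

definition represented_by :: "'n::{finite,linorder} fractal_elem \<Rightarrow> (nat \<Rightarrow> 'n level_elem) \<Rightarrow> bool" where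
  "represented_by X v \<longleftrightarrow> (\<lambda>n. (Suc n, v (Suc n))) \<in> X"

section \<open>Associated function, weak gradient, generalized jump\<close>

definition level_function :: "'n::{finite,linorder} vector set \<Rightarrow> 'n level_elem \<Rightarrow> ('n vector \<Rightarrow> real) \<Rightarrow> bool" where
  "level_function Q X u \<longleftrightarrow>
     (\<forall>s\<in>{0<..<1/2}. u \<in> sobolev_space s Q \<and>
        (\<exists>f\<in>X. (\<lambda>n. sobolev_norm_sq s Q (\<lambda>x. f n x - u x)) \<longlonglongrightarrow> 0))"

definition associated_function ::
    "'n::{finite,linorder} vector set \<Rightarrow> (nat \<Rightarrow> 'n level_elem) \<Rightarrow> ('n vector \<Rightarrow> real) \<Rightarrow> bool" where
  "associated_function Q v u \<longleftrightarrow>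
     (\<exists>U. (\<forall>K\<ge>1. level_function Q (v K) (U K)) \<and>
       (\<forall>s\<in>{0<..<1/2}. u \<in> sobolev_space s Q \<and>
          (\<lambda>K. sobolev_norm_sq s Q (\<lambda>x. u x - U K x)) \<longlonglongrightarrow> 0))"

definition level_gradient ::
    "'n::{finite,linorder} vector set \<Rightarrow> (nat \<Rightarrow> 'n vector set) \<Rightarrow> nat \<Rightarrow>
     'n level_elem \<Rightarrow> ('n vector \<Rightarrow> 'n vector) \<Rightarrow> bool" where
  "level_gradient Q \<Gamma> K X g \<longleftrightarrow>
     g \<in> L2_space (lebesgue_on (Q - interfaces_upto \<Gamma> K)) \<and>
     (\<exists>f\<in>X. (\<lambda>n. L2_norm (lebesgue_on (Q - interfaces_upto \<Gamma> K)) (\<lambda>x. grad (f n) x - g x)) \<longlonglongrightarrow> 0)"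

definition weak_gradient ::
    "'n::{finite,linorder} vector set \<Rightarrow> (nat \<Rightarrow> 'n vector set) \<Rightarrow>
     (nat \<Rightarrow> 'n level_elem) \<Rightarrow> ('n vector \<Rightarrow> 'n vector) \<Rightarrow> bool" where
  "weak_gradient Q \<Gamma> v g \<longleftrightarrow>
     g \<in> L2_space (lebesgue_on (Q - all_interfaces \<Gamma>)) \<and>
     (\<exists>gK. (\<forall>K\<ge>1. level_gradient Q \<Gamma> K (v K) (gK K)) \<and>
       (\<lambda>K. L2_norm (lebesgue_on (Q - all_interfaces \<Gamma>)) (\<lambda>x. gK K x - g x)) \<longlonglongrightarrow> 0)"

definition jump_space ::
    "(nat \<Rightarrow> 'n::{finite,linorder} vector set) \<Rightarrow> (nat \<Rightarrow> nat) \<Rightarrow> real \<Rightarrow> (nat \<Rightarrow> 'n vector \<Rightarrow> real) set" where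
  "jump_space \<Gamma> C c = {j. (\<forall>k\<ge>1. j k \<in> L2_space (surface_measure (\<Gamma> k))) \<and>
     summable (\<lambda>k. (1 + c) ^ Suc k * real (C (Suc k)) *
                   (L2_norm (surface_measure (\<Gamma> (Suc k))) (j (Suc k)))\<^sup>2)}"

definition jump_norm ::
    "(nat \<Rightarrow> 'n::{finite,linorder} vector set) \<Rightarrow> (nat \<Rightarrow> nat) \<Rightarrow> real \<Rightarrow> (nat \<Rightarrow> 'n vector \<Rightarrow> real) \<Rightarrow> real" where
  "jump_norm \<Gamma> C c j =
     sqrt (\<Sum>k. (1 + c) ^ Suc k * real (C (Suc k)) *
                (L2_norm (surface_measure (\<Gamma> (Suc k))) (j (Suc k)))\<^sup>2)"

definition level_jump ::
    "(nat \<Rightarrow> 'n::{finite,linorder} vector set) \<Rightarrow> (nat \<Rightarrow> nat) \<Rightarrow> real \<Rightarrow>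
     'n level_elem \<Rightarrow> (nat \<Rightarrow> 'n vector \<Rightarrow> real) \<Rightarrow> bool" where
  "level_jump \<Gamma> C c X j \<longleftrightarrow>
     j \<in> jump_space \<Gamma> C c \<and>
     (\<exists>f\<in>X. (\<lambda>n. jump_norm \<Gamma> C c (\<lambda>k \<xi>. jump (f n) (\<Gamma> k) \<xi> - j k \<xi>)) \<longlonglongrightarrow> 0)"

definition generalized_jump ::
    "(nat \<Rightarrow> 'n::{finite,linorder} vector set) \<Rightarrow> (nat \<Rightarrow> nat) \<Rightarrow> real \<Rightarrow>
     (nat \<Rightarrow> 'n level_elem) \<Rightarrow> (nat \<Rightarrow> 'n vector \<Rightarrow> real) \<Rightarrow> bool" where
  "generalized_jump \<Gamma> C c v j \<longleftrightarrow>
     j \<in> jump_space \<Gamma> C c \<and>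
     (\<exists>jK. (\<forall>K\<ge>1. level_jump \<Gamma> C c (v K) (jK K)) \<and>
       (\<lambda>K. jump_norm \<Gamma> C c (\<lambda>k \<xi>. jK K k \<xi> - j k \<xi>)) \<longlonglongrightarrow> 0)"

end

theory Submission
  imports Defs
begin

text \<open>Send a \<open>C\<^sup>1\<close> function of any level to the pair of its gradient on \<open>Q - all_interfaces \<Gamma>\<close> and its
  family of jumps. Interfaces are Lebesgue-negligible, and a function of level \<open>L\<close> is differentiable,
  hence has no jump, on every \<open>\<Gamma> k\<close> with \<open>k > L\<close>. So this map is isometric from every level into one
  space of pairs, and the claimed right-hand side is the inner product of that space. An
  element of the fractal space is a limit of limits of such pairs; replacing both limits by a diagonal
  sequence of \<open>C\<^sup>1\<close> functions, the claim becomes the continuity of the inner product. Completeness of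
  the space of pairs is not needed because the weak gradient and the generalized jump are given.\<close>

section \<open>Semi-inner products\<close>

text \<open>The scalar product of the fractal space is a \<open>lim\<close> along sequences picked
  by \<open>SOME\<close>, in two nested stages: a sequence of elements of arbitrary levels, and for
  each of them a sequence of smooth functions. The weak gradient and the generalized jump are limits
  along sequences of their own, possibly different ones for gradient and jump. The difficulty is to
  compare all these choices. In the one space of pairs, equivalence of sequences becomes a distance
  tending to 0, and the choices are linked by triangle inequalities. For the elements picked by
  \<open>SOME\<close> no limit pair is given, so their inner products are shown to converge from the
  Cauchy property alone. The isometry between different levels involves norms of pointwise
  differences, whose jumps are differences of jumps only almost everywhere; there the completeness
  of the surface measure enters.\<close>

text \<open>The carrier will consist of functions rather than of classes modulo null functions, so the
  inner product type classes do not apply. Read \<open>lin t x y\<close> as \<open>x + t y\<close>.\<close>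

locale semi_inner_space =
  fixes S :: "'a set" and lin :: "real \<Rightarrow> 'a \<Rightarrow> 'a \<Rightarrow> 'a" and B :: "'a \<Rightarrow> 'a \<Rightarrow> real"
  assumes lin_closed: "x \<in> S \<Longrightarrow> y \<in> S \<Longrightarrow> lin t x y \<in> S"
    and B_lin_left: "x \<in> S \<Longrightarrow> y \<in> S \<Longrightarrow> z \<in> S \<Longrightarrow> B (lin t x y) z = B x z + t * B y z"
    and B_sym: "x \<in> S \<Longrightarrow> y \<in> S \<Longrightarrow> B x y = B y x"
    and B_nonneg: "x \<in> S \<Longrightarrow> B x x \<ge> 0"
begin

definition dst :: "'a \<Rightarrow> 'a \<Rightarrow> real" where
  "dst x y = sqrt (B (lin (-1) x y) (lin (-1) x y))"

lemma B_lin_right: "x \<in> S \<Longrightarrow> y \<in> S \<Longrightarrow> z \<in> S \<Longrightarrow> B z (lin t x y) = B z x + t * B z y"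
  using B_lin_left[of x y z t] B_sym[of z "lin t x y"] B_sym[of z x] B_sym[of z y] lin_closed[of x y t]
  by simp

text \<open>The quadratic in \<open>quad\<close> is nonnegative for every \<open>t\<close>. As
  \<open>B\<close> is only semidefinite, \<open>B y y = 0\<close> is a case of its own: with
  \<open>B x y \<noteq> 0\<close> the quadratic would be a nonconstant affine function, and
  \<open>t\<close> is chosen to give it the value -1. Otherwise \<open>t\<close> is the
  minimizer.\<close>

lemma Cauchy_Schwarz:
  assumes "x \<in> S" "y \<in> S"
  shows "\<bar>B x y\<bar> \<le> sqrt (B x x) * sqrt (B y y)"
proof -
  have quad: "0 \<le> B x x + 2 * t * B x y + t\<^sup>2 * B y y" for t
    using B_nonneg[OF lin_closed[OF assms, of t]] assms
    by (simp add: B_lin_left B_lin_right lin_closed B_sym[of y x] algebra_simps power2_eq_square)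
  have "(B x y)\<^sup>2 \<le> B x x * B y y"
  proof (cases "B y y = 0")
    case True
    have "B x y = 0"
    proof (rule ccontr)
      assume "B x y \<noteq> 0"
      then have "B x x + 2 * (- (B x x + 1) / (2 * B x y)) * B x y = -1"
        by (simp add: field_simps)
      with quad[of "- (B x x + 1) / (2 * B x y)"] True show False
        by simp
    qed
    with True show ?thesis by simp
  next
    case False
    then have pos: "B y y > 0" using B_nonneg[OF assms(2)] by simp
    have "0 \<le> B x x + 2 * (- B x y / B y y) * B x y + (- B x y / B y y)\<^sup>2 * B y y"
      by (rule quad)
    also have "\<dots> = B x x - (B x y)\<^sup>2 / B y y"
      using pos by (simp add: field_simps power2_eq_square)
    finally show ?thesis using pos by (simp add: field_simps)
  qed
  then have "sqrt ((B x y)\<^sup>2) \<le> sqrt (B x x * B y y)" by (rule real_sqrt_le_mono)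
  then show ?thesis by (simp add: real_sqrt_mult)
qed

lemma dst_nonneg: "x \<in> S \<Longrightarrow> y \<in> S \<Longrightarrow> dst x y \<ge> 0"
  by (simp add: dst_def B_nonneg lin_closed)

lemma dst_power2: "x \<in> S \<Longrightarrow> y \<in> S \<Longrightarrow> (dst x y)\<^sup>2 = B x x - 2 * B x y + B y y"
  using B_nonneg[OF lin_closed, of x y "-1"]
  by (simp add: dst_def B_lin_left B_lin_right lin_closed B_sym[of y x])

lemma dst_self: "x \<in> S \<Longrightarrow> dst x x = 0"
  using dst_power2[of x x] by simp

lemma dst_sym: "x \<in> S \<Longrightarrow> y \<in> S \<Longrightarrow> dst x y = dst y x"
  by (rule power2_eq_imp_eq) (simp_all add: dst_power2 dst_nonneg B_sym[of y x])

lemma dst_triangle: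
  assumes "x \<in> S" "y \<in> S" "z \<in> S"
  shows "dst x z \<le> dst x y + dst y z"
proof (rule power2_le_imp_le)
  let ?u = "lin (-1) x y" and ?w = "lin (-1) y z"
  have uw: "?u \<in> S" "?w \<in> S" using assms lin_closed by auto
  have "(dst x z)\<^sup>2 = (dst x y)\<^sup>2 + 2 * B ?u ?w + (dst y z)\<^sup>2"
    using assms
    by (simp add: dst_power2 B_lin_left B_lin_right lin_closed B_sym[of y x] B_sym[of z x]
        B_sym[of z y] algebra_simps)
  also have "\<dots> \<le> (dst x y + dst y z)\<^sup>2"
    using Cauchy_Schwarz[OF uw] by (simp add: dst_def power2_sum)
  finally show "(dst x z)\<^sup>2 \<le> (dst x y + dst y z)\<^sup>2" .
  show "0 \<le> dst x y + dst y z" using assms dst_nonneg by simp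
qed

lemma dst_diff_le:
  assumes "x \<in> S" "y \<in> S" "x' \<in> S" "y' \<in> S"
  shows "\<bar>dst x y - dst x' y'\<bar> \<le> dst x x' + dst y y'"
proof -
  have "dst x y \<le> dst x x' + (dst x' y' + dst y' y)"
    using assms dst_triangle[of x x' y] dst_triangle[of x' y' y] by linarith
  moreover have "dst x' y' \<le> dst x' x + (dst x y + dst y y')"
    using assms dst_triangle[of x' x y'] dst_triangle[of x y y'] by linarith
  ultimately show ?thesis
    using assms by (simp add: dst_sym[of x' x] dst_sym[of y' y])
qed

text \<open>The reverse triangle inequality. The locale names no zero element, so the norm is not
  written as a distance and the bound is taken from Cauchy-Schwarz after squaring.\<close>

lemma norm_diff_le:
  assumes "x \<in> S" "y \<in> S"
  shows "\<bar>sqrt (B x x) - sqrt (B y y)\<bar> \<le> dst x y"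
proof (rule power2_le_imp_le)
  have "(sqrt (B x x) - sqrt (B y y))\<^sup>2 = B x x - 2 * (sqrt (B x x) * sqrt (B y y)) + B y y"
    using assms B_nonneg by (simp add: power2_diff)
  also have "\<dots> \<le> (dst x y)\<^sup>2"
    using Cauchy_Schwarz[OF assms] by (simp add: dst_power2 assms)
  finally show "\<bar>sqrt (B x x) - sqrt (B y y)\<bar>\<^sup>2 \<le> (dst x y)\<^sup>2" by simp
qed (simp add: dst_nonneg assms)

text \<open>Expresses \<open>B\<close> by two norms and a distance, all Lipschitz with respect to
  \<open>dst\<close>. Limits and convergence of \<open>B\<close> then follow without bounding the
  sequences.\<close>

lemma B_polarization:
  assumes "x \<in> S" "y \<in> S"
  shows "B x y = ((sqrt (B x x))\<^sup>2 + (sqrt (B y y))\<^sup>2 - (dst x y)\<^sup>2) / 2"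
  using assms B_nonneg by (simp add: dst_power2)

lemma B_tendsto:
  assumes S: "\<And>n. x n \<in> S" "\<And>n. y n \<in> S" "a \<in> S" "b \<in> S"
    and x: "(\<lambda>n. dst (x n) a) \<longlonglongrightarrow> 0" and y: "(\<lambda>n. dst (y n) b) \<longlonglongrightarrow> 0"
  shows "(\<lambda>n. B (x n) (y n)) \<longlonglongrightarrow> B a b"
proof -
  have norm: "(\<lambda>n. sqrt (B (z n) (z n))) \<longlonglongrightarrow> sqrt (B d d)"
    if "\<And>n. z n \<in> S" "d \<in> S" "(\<lambda>n. dst (z n) d) \<longlonglongrightarrow> 0" for z d
    by (rule LIM_zero_cancel, rule Lim_null_comparison[OF _ that(3)])
      (use norm_diff_le that in auto)
  have "(\<lambda>n. dst (x n) (y n)) \<longlonglongrightarrow> dst a b"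
    by (rule LIM_zero_cancel, rule Lim_null_comparison[where g = "\<lambda>n. dst (x n) a + dst (y n) b"])
      (use dst_diff_le S tendsto_add[OF x y] in auto)
  then show ?thesis
    unfolding B_polarization[OF S(1) S(2)] B_polarization[OF S(3) S(4)]
    by (intro tendsto_intros norm S x y) auto
qed

definition Cauchy_dst :: "(nat \<Rightarrow> 'a) \<Rightarrow> bool" where
  "Cauchy_dst x \<longleftrightarrow> (\<forall>n. x n \<in> S) \<and> (\<forall>\<epsilon>>0. \<exists>N. \<forall>m\<ge>N. \<forall>n\<ge>N. dst (x m) (x n) < \<epsilon>)"

text \<open>Completeness of the reals yields a limit of \<open>h\<close> even when the points
  themselves have no limit in \<open>S\<close>. Two sequences are needed for distances; for norms
  the same sequence is taken twice.\<close>

lemma Cauchy_dst_imp_convergent: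
  assumes "Cauchy_dst x" and le: "\<And>m n. \<bar>h m - h n\<bar> \<le> dst (x m) (x n) + dst (y m) (y n)"
    and "Cauchy_dst y"
  shows "convergent (h :: nat \<Rightarrow> real)"
proof (rule Cauchy_convergent, rule metric_CauchyI)
  fix e :: real assume "e > 0"
  then have "e / 2 > 0" by simp
  with assms obtain M N where "\<forall>m\<ge>M. \<forall>n\<ge>M. dst (x m) (x n) < e / 2" "\<forall>m\<ge>N. \<forall>n\<ge>N. dst (y m) (y n) < e / 2"
    unfolding Cauchy_dst_def by blast
  then have "\<forall>m\<ge>max M N. \<forall>n\<ge>max M N. dist (h m) (h n) < e"
    using le by (smt (verit) dist_real_def field_sum_of_halves max.boundedE)
  then show "\<exists>M. \<forall>m\<ge>M. \<forall>n\<ge>M. dist (h m) (h n) < e" by blast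
qed

lemma convergent_dst:
  assumes "Cauchy_dst x" "Cauchy_dst y"
  shows "convergent (\<lambda>n. dst (x n) (y n))"
  by (rule Cauchy_dst_imp_convergent[OF assms(1) _ assms(2)])
    (use dst_diff_le assms Cauchy_dst_def in auto)

lemma convergent_B:
  assumes "Cauchy_dst x" "Cauchy_dst y"
  shows "convergent (\<lambda>n. B (x n) (y n))"
proof -
  have S: "x n \<in> S" "y n \<in> S" for n using assms by (auto simp: Cauchy_dst_def)
  have norm: "convergent (\<lambda>n. sqrt (B (z n) (z n)))" if "Cauchy_dst z" for z
  proof (rule Cauchy_dst_imp_convergent[OF that _ that])
    show "\<bar>sqrt (B (z m) (z m)) - sqrt (B (z n) (z n))\<bar> \<le> dst (z m) (z n) + dst (z m) (z n)" for m n
      using norm_diff_le[of "z m" "z n"] dst_nonneg[of "z m" "z n"] that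
      by (simp add: Cauchy_dst_def)
  qed
  obtain a b d where "(\<lambda>n. sqrt (B (x n) (x n))) \<longlonglongrightarrow> a" "(\<lambda>n. sqrt (B (y n) (y n))) \<longlonglongrightarrow> b"
      "(\<lambda>n. dst (x n) (y n)) \<longlonglongrightarrow> d"
    using norm[OF assms(1)] norm[OF assms(2)] convergent_dst[OF assms]
    by (auto simp: convergent_def)
  then have "(\<lambda>n. B (x n) (y n)) \<longlonglongrightarrow> (a\<^sup>2 + b\<^sup>2 - d\<^sup>2) / 2"
    unfolding B_polarization[OF S] by (intro tendsto_intros) auto
  then show ?thesis by (rule convergentI)
qed

end

section \<open>Square-integrable functions\<close>

text \<open>Preimages under \<open>f\<close> and \<open>g\<close> differ by part of a null set,
  which is measurable by completeness. It serves for the jump of a difference of functions, which is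
  known only almost everywhere and hence not known to be measurable in advance.\<close>

lemma (in complete_measure) measurable_cong_AE:
  assumes "f \<in> M \<rightarrow>\<^sub>M N" and ae: "AE x in M. f x = g x" and sp: "g \<in> space M \<rightarrow> space N"
  shows "g \<in> M \<rightarrow>\<^sub>M N"
proof (rule measurableI)
  fix A assume "A \<in> sets N"
  then have "f -` A \<inter> space M \<in> sets M" using assms(1) by measurable
  moreover have "AE x in M. x \<in> f -` A \<inter> space M \<longleftrightarrow> x \<in> g -` A \<inter> space M"
    using ae by eventually_elim auto
  ultimately show "g -` A \<inter> space M \<in> sets M"
    by (intro in_sets_AE[of "f -` A \<inter> space M" "g -` A \<inter> space M", OF _ _ Int_lower2])
qed (use sp in auto)

lemma (in complete_measure) integral_cong_AE_complete:
  fixes f g :: "'a \<Rightarrow> 'b::{banach, second_countable_topology}"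
  assumes "f \<in> borel_measurable M" "AE x in M. f x = g x"
  shows "integral\<^sup>L M g = integral\<^sup>L M f"
proof (rule integral_cong_AE)
  show "g \<in> borel_measurable M" by (rule measurable_cong_AE[OF assms]) simp
  show "AE x in M. g x = f x" using assms(2) by eventually_elim simp
qed (rule assms(1))

lemma L2_space_integrable_inner:
  assumes "f \<in> L2_space M" "g \<in> L2_space M"
  shows "integrable M (\<lambda>x. f x \<bullet> g x)"
proof (rule Bochner_Integration.integrable_bound)
  show "integrable M (\<lambda>x. (norm (f x))\<^sup>2 + (norm (g x))\<^sup>2)"
    using assms by (simp add: L2_space_def)
  show "(\<lambda>x. f x \<bullet> g x) \<in> borel_measurable M"
    using assms by (auto simp: L2_space_def)
  have "norm (f x \<bullet> g x) \<le> norm ((norm (f x))\<^sup>2 + (norm (g x))\<^sup>2)" for x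
  proof -
    have "\<bar>f x \<bullet> g x\<bar> \<le> norm (f x) * norm (g x)" by (rule Cauchy_Schwarz_ineq2)
    moreover have "2 * (norm (f x) * norm (g x)) \<le> (norm (f x))\<^sup>2 + (norm (g x))\<^sup>2"
      using sum_squares_bound[of "norm (f x)" "norm (g x)"] by simp
    moreover have "0 \<le> norm (f x) * norm (g x)" by simp
    ultimately have "\<bar>f x \<bullet> g x\<bar> \<le> (norm (f x))\<^sup>2 + (norm (g x))\<^sup>2" by linarith
    then show ?thesis by simp
  qed
  then show "AE x in M. norm (f x \<bullet> g x) \<le> norm ((norm (f x))\<^sup>2 + (norm (g x))\<^sup>2)" by simp
qed

lemma L2_space_add_scaleR:
  assumes "f \<in> L2_space M" "g \<in> L2_space M"
  shows "(\<lambda>x. f x + t *\<^sub>R g x) \<in> L2_space M"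
proof -
  have "integrable M (\<lambda>x. (norm (f x))\<^sup>2 + 2 * t * (f x \<bullet> g x) + t\<^sup>2 * (norm (g x))\<^sup>2)"
    using assms L2_space_integrable_inner[OF assms] by (simp add: L2_space_def)
  moreover have "(norm (f x + t *\<^sub>R g x))\<^sup>2 = (norm (f x))\<^sup>2 + 2 * t * (f x \<bullet> g x) + t\<^sup>2 * (norm (g x))\<^sup>2" for x
    unfolding power2_norm_eq_inner
    by (simp add: inner_add_left inner_add_right inner_commute[of "g x" "f x"] power2_eq_square algebra_simps)
  ultimately show ?thesis
    using assms by (auto simp: L2_space_def)
qed

lemma L2_norm_power2: "(L2_norm M f)\<^sup>2 = (\<integral>x. f x \<bullet> f x \<partial>M)"
  by (simp add: L2_norm_def power2_norm_eq_inner)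

lemma L2_norm_nonneg: "L2_norm M f \<ge> 0"
  by (simp add: L2_norm_def)

text \<open>Both integrals are integrals over the whole space of \<open>f\<close> times an
  indicator, and the indicators agree off the null set \<open>A - E\<close>. This moves gradients
  from the complement of finitely many interfaces to the complement of all of them.\<close>

lemma
  fixes f :: "'a::euclidean_space \<Rightarrow> 'b::{banach, second_countable_topology}"
  assumes "A \<in> sets lebesgue" "E \<subseteq> A" "negligible (A - E)"
  shows integral_lebesgue_on_subset_negligible:
      "f \<in> borel_measurable (lebesgue_on A) \<Longrightarrow>
       integral\<^sup>L (lebesgue_on E) f = integral\<^sup>L (lebesgue_on A) f"
    and integrable_lebesgue_on_subset_negligible:
      "integrable (lebesgue_on A) f \<Longrightarrow> integrable (lebesgue_on E) f"
proof -
  have N: "A - E \<in> null_sets lebesgue" using assms(3) by (simp add: negligible_iff_null_sets)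
  have E: "E = A - (A - E)" using assms(2) by auto
  have Eset: "E \<in> sets lebesgue"
    using assms(1) N by (subst E) auto
  show "integrable (lebesgue_on E) f" if "integrable (lebesgue_on A) f"
  proof -
    have "integrable lebesgue (\<lambda>x. indicator A x *\<^sub>R f x)"
      using that assms(1) by (simp add: integrable_restrict_space)
    then have "integrable lebesgue (\<lambda>x. indicator E x *\<^sub>R indicator A x *\<^sub>R f x)"
      by (rule integrable_mult_indicator[OF Eset])
    moreover have "indicator E x *\<^sub>R indicator A x *\<^sub>R f x = indicator E x *\<^sub>R f x" for x
      using assms(2) by (auto simp: indicator_def)
    ultimately have "integrable lebesgue (\<lambda>x. indicator E x *\<^sub>R f x)" by (simp only:)
    then show ?thesis using Eset by (simp add: integrable_restrict_space)
  qed
  show "integral\<^sup>L (lebesgue_on E) f = integral\<^sup>L (lebesgue_on A) f" if f: "f \<in> borel_measurable (lebesgue_on A)"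
  proof -
    have mA: "(\<lambda>x. indicator A x *\<^sub>R f x) \<in> borel_measurable lebesgue"
      using f assms(1) by (simp add: borel_measurable_restrict_space_iff)
    have "f \<in> borel_measurable (lebesgue_on E)"
      using f assms(2) by (rule measurable_restrict_mono)
    then have mE: "(\<lambda>x. indicator E x *\<^sub>R f x) \<in> borel_measurable lebesgue"
      using Eset by (simp add: borel_measurable_restrict_space_iff)
    have "AE x in lebesgue. x \<notin> A - E" using N by (rule AE_not_in)
    then have "AE x in lebesgue. indicator E x *\<^sub>R f x = indicator A x *\<^sub>R f x"
      by eventually_elim (use assms(2) in \<open>auto simp: indicator_def\<close>)
    from integral_cong_AE[OF mE mA this] show ?thesis
      using assms(1) Eset by (simp add: integral_restrict_space)
  qed
qed

lemma L2_space_lebesgue_on_subset: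
  assumes "A \<in> sets lebesgue" "E \<subseteq> A" "negligible (A - E)" "f \<in> L2_space (lebesgue_on A)"
  shows "f \<in> L2_space (lebesgue_on E)"
proof -
  have "f \<in> borel_measurable (lebesgue_on E)"
    using assms(4) by (intro measurable_restrict_mono[OF _ assms(2)]) (simp add: L2_space_def)
  moreover have "integrable (lebesgue_on E) (\<lambda>x. (norm (f x))\<^sup>2)"
    using assms(4) by (intro integrable_lebesgue_on_subset_negligible[OF assms(1-3)]) (simp add: L2_space_def)
  ultimately show ?thesis by (simp add: L2_space_def)
qed

section \<open>Completions\<close>

text \<open>A quotient class is the image of a single sequence, so no equivalence relation has to be
  established. That \<open>x\<close> lies in its own class has to wait until \<open>d\<close> is
  known to vanish on the diagonal, as in \<open>representative_in\<close>.\<close>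

lemma cauchy_completion_cases:
  assumes "X \<in> cauchy_completion V d"
  obtains x where "x \<in> cauchy_seqs V d"
    "X = {f \<in> cauchy_seqs V d. (\<lambda>n. d (x n) (f n)) \<longlonglongrightarrow> 0}"
proof -
  from assms obtain x where x: "x \<in> cauchy_seqs V d"
    "X = {(f, g). f \<in> cauchy_seqs V d \<and> g \<in> cauchy_seqs V d \<and> (\<lambda>n. d (f n) (g n)) \<longlonglongrightarrow> 0} `` {x}"
    unfolding cauchy_completion_def by (rule quotientE)
  then have "X = {f \<in> cauchy_seqs V d. (\<lambda>n. d (x n) (f n)) \<longlonglongrightarrow> 0}" by auto
  with x(1) show ?thesis by (rule that)
qed

lemma cauchy_completion_subset: "X \<in> cauchy_completion V d \<Longrightarrow> f \<in> X \<Longrightarrow> f \<in> cauchy_seqs V d"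
  by (erule cauchy_completion_cases) auto

text \<open>The choice made inside \<open>extend_form\<close>, named so that it can be folded
  there.\<close>

definition representative :: "'a set \<Rightarrow> 'a" where
  "representative X = (SOME f. f \<in> X)"

lemma representative_in:
  assumes "X \<in> cauchy_completion V d" and "\<And>x. x \<in> V \<Longrightarrow> d x x = 0"
  shows "representative X \<in> X"
proof -
  obtain x where x: "x \<in> cauchy_seqs V d" "X = {f \<in> cauchy_seqs V d. (\<lambda>n. d (x n) (f n)) \<longlonglongrightarrow> 0}"
    using assms(1) by (rule cauchy_completion_cases)
  then have "x \<in> X" using assms(2) by (auto simp: cauchy_seqs_def)
  then show ?thesis unfolding representative_def by (rule someI[of "\<lambda>f. f \<in> X"])
qed

section \<open>Gradients, jumps and the interface network\<close>

lemma grad_eqI: "GDERIV f x :> D \<Longrightarrow> grad f x = D"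
  unfolding grad_def
proof (rule the_equality)
  fix D' assume "GDERIV f x :> D'" "GDERIV f x :> D"
  then have "(\<lambda>h. h \<bullet> D') = (\<lambda>h. h \<bullet> D)"
    unfolding gderiv_def by (rule has_derivative_unique)
  then show "D' = D" by (metis vector_eq_ldot inner_commute)
qed

lemma jump_eqI: "(jump_quotient v S \<xi> \<longlongrightarrow> l) (at_right 0) \<Longrightarrow> jump v S \<xi> = l"
  unfolding jump_def by (rule tendsto_Lim) simp_all

text \<open>Both sample points tend to \<xi> whatever vector \<open>oriented_normal S \<xi>\<close>
  denotes, so the limit exists at every point of continuity and not just almost everywhere.\<close>

lemma jump_quotient_tendsto_0:
  assumes "isCont v \<xi>"
  shows "(jump_quotient v S \<xi> \<longlongrightarrow> 0) (at_right 0)"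
proof -
  let ?\<nu> = "oriented_normal S \<xi>"
  have "((\<lambda>s. \<xi> + s *\<^sub>R ?\<nu>) \<longlongrightarrow> \<xi>) (at_right 0)" "((\<lambda>s. \<xi> - s *\<^sub>R ?\<nu>) \<longlongrightarrow> \<xi>) (at_right 0)"
    by (auto intro!: tendsto_eq_intros)
  then have "((\<lambda>s. v (\<xi> + s *\<^sub>R ?\<nu>) - v (\<xi> - s *\<^sub>R ?\<nu>)) \<longlongrightarrow> v \<xi> - v \<xi>) (at_right 0)"
    by (intro tendsto_diff isCont_tendsto_compose[OF assms])
  then show ?thesis by (simp add: jump_quotient_def[abs_def])
qed

lemma GDERIV_isCont: "GDERIV f x :> D \<Longrightarrow> isCont f x"
  unfolding gderiv_def by (rule has_derivative_continuous)

text \<open>The set is covered by finitely many affine sets of codimension 1; each is its own affine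
  hull, hence a hyperplane, hence a null set.\<close>

lemma negligible_piecewise_affine:
  fixes S :: "'n::{finite,linorder} vector set"
  assumes "piecewise_affine S"
  shows "negligible S"
proof -
  obtain F where F: "finite F" "\<forall>H\<in>F. affine H \<and> aff_dim H = int CARD('n) - 1" "S \<subseteq> \<Union>F"
    using assms unfolding piecewise_affine_def by blast
  have "negligible H" if "H \<in> F" for H
  proof -
    have "aff_dim H = int DIM('n vector) - 1" using F(2) that by simp
    then obtain a b where "a \<noteq> 0" "affine hull H = {x. a \<bullet> x = b}"
      using aff_dim_eq_hyperplane[of H] by auto
    moreover have "affine hull H = H" using F(2) that by (simp add: affine_hull_eq)
    ultimately show ?thesis using negligible_hyperplane by metis
  qed
  then have "negligible (\<Union>F)" using F(1) by (intro negligible_Union) auto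
  then show ?thesis using F(3) by (rule negligible_subset)
qed

lemma space_surface_measure: "space (surface_measure S) = S"
  by (simp add: surface_measure_def space_restrict_space hausdorff_measure_def)

locale interface_network =
  fixes Q :: "'n::{finite,linorder} vector set" and \<Gamma> :: "nat \<Rightarrow> 'n vector set"
    and C :: "nat \<Rightarrow> nat" and c :: real
  assumes network: "multiscale_network Q \<Gamma> C" and c_pos: "c > 0"
begin

abbreviation "cell_union K \<equiv> Q - interfaces_upto \<Gamma> K"
abbreviation "domain \<equiv> Q - all_interfaces \<Gamma>"
abbreviation "surface k \<equiv> surface_measure (\<Gamma> k)"

definition weight :: "nat \<Rightarrow> real" where
  "weight k = (1 + c) ^ k * real (C k)"

lemma weight_nonneg: "weight k \<ge> 0"
  using c_pos by (simp add: weight_def)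

section \<open>The space of pairs of a gradient field and a family of jumps\<close>

definition pair_space :: "(('n vector \<Rightarrow> 'n vector) \<times> (nat \<Rightarrow> 'n vector \<Rightarrow> real)) set" where
  "pair_space = L2_space (lebesgue_on domain) \<times> jump_space \<Gamma> C c"

definition pair_lin where
  "pair_lin t p q = (\<lambda>x::'n vector. fst p x + t *\<^sub>R (fst q x :: 'n vector),
     \<lambda>(k::nat) (\<xi>::'n vector). snd p k \<xi> + t * snd q k \<xi>)" for t :: real

text \<open>Interfaces are numbered from 1 whereas the series starts at 0; hence
  \<open>Suc k\<close> here and below.\<close>

definition pair_inner where
  "pair_inner p q = (\<integral>x. fst p x \<bullet> (fst q x :: 'n vector) \<partial>lebesgue_on domain) +
     (\<Sum>k. weight (Suc k) * (\<integral>\<xi>. snd p (Suc k) \<xi> * snd q (Suc k) \<xi> \<partial>surface (Suc k)))"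

lemma jump_space_iff:
  "j \<in> jump_space \<Gamma> C c \<longleftrightarrow> (\<forall>k. j (Suc k) \<in> L2_space (surface (Suc k))) \<and>
     summable (\<lambda>k. weight (Suc k) * (\<integral>\<xi>. j (Suc k) \<xi> * j (Suc k) \<xi> \<partial>surface (Suc k)))"
proof -
  have "(\<forall>k\<ge>1. j k \<in> L2_space (surface k)) \<longleftrightarrow> (\<forall>k. j (Suc k) \<in> L2_space (surface (Suc k)))"
    by (metis One_nat_def Suc_le_mono le0 Suc_le_D)
  then show ?thesis
    by (simp add: jump_space_def L2_norm_power2 weight_def)
qed

lemma jump_space_integrable:
  assumes "i \<in> jump_space \<Gamma> C c" "j \<in> jump_space \<Gamma> C c"
  shows "integrable (surface (Suc k)) (\<lambda>\<xi>. i (Suc k) \<xi> * j (Suc k) \<xi>)"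
  using L2_space_integrable_inner[of "i (Suc k)" _ "j (Suc k)"] assms
  by (simp add: jump_space_iff)

lemma jump_space_summable:
  assumes i: "i \<in> jump_space \<Gamma> C c" and j: "j \<in> jump_space \<Gamma> C c"
  shows "summable (\<lambda>k. weight (Suc k) * (\<integral>\<xi>. i (Suc k) \<xi> * j (Suc k) \<xi> \<partial>surface (Suc k)))"
proof (rule summable_comparison_test')
  let ?I = "\<lambda>i j k. \<integral>\<xi>. i (Suc k) \<xi> * j (Suc k) \<xi> \<partial>surface (Suc k)"
  show "summable (\<lambda>k. weight (Suc k) * ?I i i k + weight (Suc k) * ?I j j k)"
    using i j by (intro summable_add) (simp_all add: jump_space_iff)
  fix k
  have "\<bar>?I i j k\<bar> \<le> (\<integral>\<xi>. \<bar>i (Suc k) \<xi> * j (Suc k) \<xi>\<bar> \<partial>surface (Suc k))"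
    by (rule integral_abs_bound)
  also have "\<dots> \<le> (\<integral>\<xi>. i (Suc k) \<xi> * i (Suc k) \<xi> + j (Suc k) \<xi> * j (Suc k) \<xi> \<partial>surface (Suc k))"
  proof (rule integral_mono)
    show "\<bar>a * b\<bar> \<le> a * a + b * b" for a b :: real
      using sum_squares_bound[of a b] sum_squares_bound[of a "- b"] by (auto simp: power2_eq_square abs_if)
  qed (simp_all add: jump_space_integrable i j)
  also have "\<dots> = ?I i i k + ?I j j k"
    by (simp add: jump_space_integrable i j)
  finally show "norm (weight (Suc k) * ?I i j k) \<le> weight (Suc k) * ?I i i k + weight (Suc k) * ?I j j k"
    using weight_nonneg[of "Suc k"]
    by (simp add: abs_mult flip: distrib_left) (rule mult_left_mono)
qed

lemma jump_space_lin:
  assumes i: "i \<in> jump_space \<Gamma> C c" and j: "j \<in> jump_space \<Gamma> C c"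
  shows "(\<lambda>k \<xi>. i k \<xi> + t * j k \<xi>) \<in> jump_space \<Gamma> C c"
  unfolding jump_space_iff
proof (intro conjI allI)
  fix k
  show "(\<lambda>\<xi>. i (Suc k) \<xi> + t * j (Suc k) \<xi>) \<in> L2_space (surface (Suc k))"
    using L2_space_add_scaleR[of "i (Suc k)" _ "j (Suc k)" t] i j by (simp add: jump_space_iff)
next
  let ?I = "\<lambda>i j k. \<integral>\<xi>. i (Suc k) \<xi> * j (Suc k) \<xi> \<partial>surface (Suc k)"
  have "(\<integral>\<xi>. (i (Suc k) \<xi> + t * j (Suc k) \<xi>) * (i (Suc k) \<xi> + t * j (Suc k) \<xi>) \<partial>surface (Suc k)) =
      ?I i i k + 2 * t * ?I i j k + t\<^sup>2 * ?I j j k" for k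
  proof -
    have "(i (Suc k) \<xi> + t * j (Suc k) \<xi>) * (i (Suc k) \<xi> + t * j (Suc k) \<xi>) =
        i (Suc k) \<xi> * i (Suc k) \<xi> + 2 * t * (i (Suc k) \<xi> * j (Suc k) \<xi>) + t\<^sup>2 * (j (Suc k) \<xi> * j (Suc k) \<xi>)" for \<xi>
      by (simp add: algebra_simps power2_eq_square)
    then show ?thesis using jump_space_integrable i j by simp
  qed
  then have "weight (Suc k) * (\<integral>\<xi>. (i (Suc k) \<xi> + t * j (Suc k) \<xi>) * (i (Suc k) \<xi> + t * j (Suc k) \<xi>) \<partial>surface (Suc k)) =
      weight (Suc k) * ?I i i k + 2 * t * (weight (Suc k) * ?I i j k) + t\<^sup>2 * (weight (Suc k) * ?I j j k)" for k
    by (simp add: algebra_simps)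
  moreover have "summable (\<lambda>k. weight (Suc k) * ?I i i k + 2 * t * (weight (Suc k) * ?I i j k) + t\<^sup>2 * (weight (Suc k) * ?I j j k))"
    by (intro summable_add summable_mult jump_space_summable i j)
  ultimately show "summable (\<lambda>k. weight (Suc k) *
      (\<integral>\<xi>. (i (Suc k) \<xi> + t * j (Suc k) \<xi>) * (i (Suc k) \<xi> + t * j (Suc k) \<xi>) \<partial>surface (Suc k)))"
    by (simp only:)
qed

text \<open>Linearity splits integrals and a series, which is legitimate because all mixed products
  are integrable and all mixed series converge.\<close>

sublocale pairs: semi_inner_space pair_space pair_lin pair_inner
proof
  fix p q :: "('n vector \<Rightarrow> 'n vector) \<times> (nat \<Rightarrow> 'n vector \<Rightarrow> real)" and t
  assume p: "p \<in> pair_space" and q: "q \<in> pair_space"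
  then show "pair_lin t p q \<in> pair_space"
    by (auto simp: pair_space_def pair_lin_def L2_space_add_scaleR jump_space_lin)
  show "pair_inner p q = pair_inner q p"
    by (simp add: pair_inner_def inner_commute mult.commute)
  fix r assume r: "r \<in> pair_space"
  let ?I = "\<lambda>p q k. \<integral>\<xi>. snd p (Suc k) \<xi> * snd q (Suc k) \<xi> \<partial>surface (Suc k)"
  have sp: "snd p \<in> jump_space \<Gamma> C c" "snd q \<in> jump_space \<Gamma> C c" "snd r \<in> jump_space \<Gamma> C c"
    and fp: "fst p \<in> L2_space (lebesgue_on domain)" "fst q \<in> L2_space (lebesgue_on domain)"
      "fst r \<in> L2_space (lebesgue_on domain)"
    using p q r by (auto simp: pair_space_def)
  have "(\<integral>x. (fst p x + t *\<^sub>R fst q x) \<bullet> fst r x \<partial>lebesgue_on domain) =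
      (\<integral>x. fst p x \<bullet> fst r x \<partial>lebesgue_on domain) + t * (\<integral>x. fst q x \<bullet> fst r x \<partial>lebesgue_on domain)"
    using fp by (simp add: inner_add_left L2_space_integrable_inner)
  moreover have "(\<Sum>k. weight (Suc k) * (\<integral>\<xi>. (snd p (Suc k) \<xi> + t * snd q (Suc k) \<xi>) * snd r (Suc k) \<xi> \<partial>surface (Suc k))) =
      (\<Sum>k. weight (Suc k) * ?I p r k) + t * (\<Sum>k. weight (Suc k) * ?I q r k)"
  proof -
    have "(\<integral>\<xi>. (snd p (Suc k) \<xi> + t * snd q (Suc k) \<xi>) * snd r (Suc k) \<xi> \<partial>surface (Suc k)) =
        ?I p r k + t * ?I q r k" for k
      using jump_space_integrable[OF sp(1) sp(3)] jump_space_integrable[OF sp(2) sp(3)]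
      by (simp add: distrib_right mult.assoc)
    then have "(\<Sum>k. weight (Suc k) * (\<integral>\<xi>. (snd p (Suc k) \<xi> + t * snd q (Suc k) \<xi>) * snd r (Suc k) \<xi> \<partial>surface (Suc k))) =
        (\<Sum>k. weight (Suc k) * ?I p r k + t * (weight (Suc k) * ?I q r k))"
      by (simp add: algebra_simps)
    also have "\<dots> = (\<Sum>k. weight (Suc k) * ?I p r k) + t * (\<Sum>k. weight (Suc k) * ?I q r k)"
      using jump_space_summable[OF sp(1) sp(3)] jump_space_summable[OF sp(2) sp(3)]
      by (simp add: suminf_mult suminf_add[symmetric] summable_mult)
    finally show ?thesis .
  qed
  ultimately show "pair_inner (pair_lin t p q) r = pair_inner p r + t * pair_inner q r"
    by (simp add: pair_inner_def pair_lin_def algebra_simps)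
next
  fix p assume p: "p \<in> pair_space"
  then have "summable (\<lambda>k. weight (Suc k) * (\<integral>\<xi>. snd p (Suc k) \<xi> * snd p (Suc k) \<xi> \<partial>surface (Suc k)))"
    by (auto simp: pair_space_def jump_space_iff)
  then show "pair_inner p p \<ge> 0"
    unfolding pair_inner_def
    by (intro add_nonneg_nonneg suminf_nonneg mult_nonneg_nonneg weight_nonneg integral_nonneg_AE) auto
qed

text \<open>Pythagoras: the gradient part and the jump part are orthogonal. It allows one component
  of a pair to be changed at a time.\<close>

lemma pairs_dst_power2:
  "(pairs.dst (g, i) (h, j))\<^sup>2 =
     (L2_norm (lebesgue_on domain) (\<lambda>x. g x - h x))\<^sup>2 + (jump_norm \<Gamma> C c (\<lambda>k \<xi>. i k \<xi> - j k \<xi>))\<^sup>2"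
  if "(g, i) \<in> pair_space" "(h, j) \<in> pair_space"
proof -
  have "(\<lambda>k \<xi>. i k \<xi> + (-1) * j k \<xi>) \<in> jump_space \<Gamma> C c"
    using that by (intro jump_space_lin) (auto simp: pair_space_def)
  then have "summable (\<lambda>k. weight (Suc k) *
      (\<integral>\<xi>. (i (Suc k) \<xi> - j (Suc k) \<xi>) * (i (Suc k) \<xi> - j (Suc k) \<xi>) \<partial>surface (Suc k)))"
    by (simp add: jump_space_iff)
  \<comment> \<open>\<open>jump_norm\<close> is a root, so squaring it returns the series only if
    the series is nonnegative; for \<open>suminf\<close> this uses summability.\<close>
  then have "0 \<le> (\<Sum>k. weight (Suc k) *
      (\<integral>\<xi>. (i (Suc k) \<xi> - j (Suc k) \<xi>) * (i (Suc k) \<xi> - j (Suc k) \<xi>) \<partial>surface (Suc k)))"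
    by (intro suminf_nonneg mult_nonneg_nonneg weight_nonneg integral_nonneg_AE) auto
  then have "(jump_norm \<Gamma> C c (\<lambda>k \<xi>. i k \<xi> - j k \<xi>))\<^sup>2 = (\<Sum>k. weight (Suc k) *
      (\<integral>\<xi>. (i (Suc k) \<xi> - j (Suc k) \<xi>) * (i (Suc k) \<xi> - j (Suc k) \<xi>) \<partial>surface (Suc k)))"
    by (simp add: jump_norm_def L2_norm_power2 weight_def)
  moreover have "(pairs.dst (g, i) (h, j))\<^sup>2 = pair_inner (pair_lin (-1) (g, i) (h, j)) (pair_lin (-1) (g, i) (h, j))"
    using pairs.B_nonneg[OF pairs.lin_closed[OF that]] by (simp add: pairs.dst_def)
  ultimately show ?thesis
    by (simp add: pair_inner_def pair_lin_def L2_norm_power2)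
qed

subsection \<open>Gradient and jumps of a level function\<close>

lemma open_cell_union:
  assumes "K \<ge> 1"
  shows "open (cell_union K)"
proof -
  have "open (\<Union>(cells Q \<Gamma> K))"
    using network assms by (auto simp: multiscale_network_def)
  then show ?thesis by (simp add: cells_def Union_components)
qed

lemma cell_union_sets: "K \<ge> 1 \<Longrightarrow> cell_union K \<in> sets lebesgue"
  using open_cell_union by (intro sets_completionI_sets) simp

lemma domain_subset: "domain \<subseteq> cell_union K"
  by (auto simp: all_interfaces_def interfaces_upto_def)

lemma cell_union_antimono: "L \<le> M \<Longrightarrow> cell_union M \<subseteq> cell_union L"
  by (auto simp: interfaces_upto_def)

lemma negligible_cell_union_diff: "negligible (cell_union K - domain)"
proof -
  have "all_interfaces \<Gamma> = (\<Union>k. \<Gamma> (Suc k))"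
    unfolding all_interfaces_def by (auto simp: Suc_le_eq gr0_conv_Suc)
  moreover have "negligible (\<Union>k. \<Gamma> (Suc k))"
    using network by (intro negligible_Union_nat negligible_piecewise_affine)
      (auto simp: multiscale_network_def)
  ultimately show ?thesis by (auto elim: negligible_subset)
qed

text \<open>Since the interfaces are disjoint, the later ones lie where functions of level
  \<open>L\<close> are differentiable. This is why a level embeds isometrically into the higher
  ones.\<close>

lemma interface_subset_cell_union:
  assumes "k > L"
  shows "\<Gamma> k \<subseteq> cell_union L"
proof -
  have "\<Gamma> k \<inter> \<Gamma> i = {}" if "i \<in> {1..L}" for i
    using network assms that unfolding multiscale_network_def disjoint_family_on_def by auto
  moreover have "\<Gamma> k \<subseteq> Q" using network assms by (auto simp: multiscale_network_def)
  ultimately show ?thesis unfolding interfaces_upto_def by blast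
qed

lemma C1_space_GDERIV:
  assumes "f \<in> C1_space Q \<Gamma> K" "x \<in> cell_union K"
  shows "GDERIV f x :> grad f x"
proof -
  obtain G where "G \<in> cells Q \<Gamma> K" "x \<in> G"
    using assms(2) Union_components[of "cell_union K"] unfolding cells_def by blast
  with assms(1) obtain D where "GDERIV f x :> D"
    unfolding C1_space_def by blast
  then show ?thesis using grad_eqI by metis
qed

lemma C1_space_jump_quotient_tendsto_0:
  assumes "f \<in> C1_space Q \<Gamma> L" "k > L" "\<xi> \<in> \<Gamma> k"
  shows "(jump_quotient f (\<Gamma> k) \<xi> \<longlongrightarrow> 0) (at_right 0)"
proof (rule jump_quotient_tendsto_0, rule GDERIV_isCont, rule C1_space_GDERIV[OF assms(1)])
  show "\<xi> \<in> cell_union L" using interface_subset_cell_union[OF assms(2)] assms(3) by blast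
qed

lemma C1_space_jump_eq_0:
  "f \<in> C1_space Q \<Gamma> L \<Longrightarrow> k > L \<Longrightarrow> \<xi> \<in> \<Gamma> k \<Longrightarrow> jump f (\<Gamma> k) \<xi> = 0"
  by (rule jump_eqI, rule C1_space_jump_quotient_tendsto_0)

text \<open>Up to \<open>L\<close> convergence is part of \<open>C1_space\<close>, beyond
  \<open>L\<close> the limit is 0 by continuity. Having it on every interface makes the jumps of
  functions of different levels subtract almost everywhere.\<close>

lemma C1_space_jump_quotient_tendsto:
  assumes "f \<in> C1_space Q \<Gamma> L" "k \<ge> 1"
  shows "AE \<xi> in surface k. (jump_quotient f (\<Gamma> k) \<xi> \<longlongrightarrow> jump f (\<Gamma> k) \<xi>) (at_right 0)"
proof (cases "k \<le> L")
  case True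
  then have "AE \<xi> in surface k. \<exists>l. (jump_quotient f (\<Gamma> k) \<xi> \<longlongrightarrow> l) (at_right 0)"
    using assms by (auto simp: C1_space_def)
  then show ?thesis by eventually_elim (use jump_eqI in metis)
next
  case False
  then show ?thesis
    using C1_space_jump_quotient_tendsto_0[OF assms(1)] C1_space_jump_eq_0[OF assms(1)]
    by (intro AE_I2) (auto simp: space_surface_measure)
qed

definition grad_jump :: "('n vector \<Rightarrow> real) \<Rightarrow> ('n vector \<Rightarrow> 'n vector) \<times> (nat \<Rightarrow> 'n vector \<Rightarrow> real)" where
  "grad_jump f = (grad f, \<lambda>k. jump f (\<Gamma> k))"

lemma C1_space_jump_L2:
  assumes "f \<in> C1_space Q \<Gamma> L" "k \<ge> 1"
  shows "jump f (\<Gamma> k) \<in> L2_space (surface k)"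
proof (cases "k \<le> L")
  case True
  then show ?thesis using assms by (auto simp: C1_space_def)
next
  case False
  then have zero: "jump f (\<Gamma> k) \<xi> = 0" if "\<xi> \<in> space (surface k)" for \<xi>
    using that C1_space_jump_eq_0[OF assms(1)] by (simp add: space_surface_measure)
  have "jump f (\<Gamma> k) \<in> borel_measurable (surface k) \<longleftrightarrow> (\<lambda>\<xi>. 0::real) \<in> borel_measurable (surface k)"
    by (rule measurable_cong) (rule zero)
  moreover have "integrable (surface k) (\<lambda>\<xi>. (norm (jump f (\<Gamma> k) \<xi>))\<^sup>2) \<longleftrightarrow> integrable (surface k) (\<lambda>\<xi>. 0::real)"
    by (rule Bochner_Integration.integrable_cong) (simp_all add: zero)
  ultimately show ?thesis by (simp add: L2_space_def)
qed

lemma grad_jump_in: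
  assumes f: "f \<in> C1_space Q \<Gamma> L" and "L \<ge> 1"
  shows "grad_jump f \<in> pair_space"
proof -
  have "grad f \<in> L2_space (lebesgue_on (cell_union L))"
    using f by (simp add: C1_space_def)
  then have "grad f \<in> L2_space (lebesgue_on domain)"
    by (rule L2_space_lebesgue_on_subset[OF cell_union_sets[OF \<open>L \<ge> 1\<close>] domain_subset negligible_cell_union_diff])
  moreover have "summable (\<lambda>k. weight (Suc k) * (\<integral>\<xi>. jump f (\<Gamma> (Suc k)) \<xi> * jump f (\<Gamma> (Suc k)) \<xi> \<partial>surface (Suc k)))"
  \<comment> \<open>For \<open>k \<ge> L\<close> the interface concerned has number
    \<open>Suc k > L\<close>, where the jump vanishes.\<close>
  proof (rule summable_finite[of "{..<L}"])
    fix k assume "k \<notin> {..<L}"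
    then have "(\<integral>\<xi>. jump f (\<Gamma> (Suc k)) \<xi> * jump f (\<Gamma> (Suc k)) \<xi> \<partial>surface (Suc k)) = (\<integral>\<xi>. 0 \<partial>surface (Suc k))"
      using C1_space_jump_eq_0[OF f] by (intro Bochner_Integration.integral_cong) (auto simp: space_surface_measure)
    then show "weight (Suc k) * (\<integral>\<xi>. jump f (\<Gamma> (Suc k)) \<xi> * jump f (\<Gamma> (Suc k)) \<xi> \<partial>surface (Suc k)) = 0"
      by simp
  qed simp
  ultimately show ?thesis
    using C1_space_jump_L2[OF f] by (simp add: grad_jump_def pair_space_def jump_space_iff)
qed

text \<open>Applied to differences of \<open>C\<^sup>1\<close> functions of different levels, where it avoids showing that such
  differences lie in a level space.\<close>

definition has_grad_jump_upto :: "nat \<Rightarrow> ('n vector \<Rightarrow> real) \<Rightarrow>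
    ('n vector \<Rightarrow> 'n vector) \<times> (nat \<Rightarrow> 'n vector \<Rightarrow> real) \<Rightarrow> bool" where
  "has_grad_jump_upto M u p \<longleftrightarrow>
     fst p \<in> borel_measurable (lebesgue_on (cell_union M)) \<and>
     (\<forall>x\<in>cell_union M. grad u x = fst p x) \<and>
     (\<forall>k\<in>{1..M}. snd p k \<in> borel_measurable (surface k) \<and> (AE \<xi> in surface k. jump u (\<Gamma> k) \<xi> = snd p k \<xi>)) \<and>
     (\<forall>k>M. \<forall>\<xi>\<in>\<Gamma> k. snd p k \<xi> = 0)"

text \<open>The removed interfaces are null sets, which settles the gradients, and the series of
  jumps stops at \<open>M\<close> because the components of \<open>p\<close> vanish beyond. On the
  first \<open>M\<close> interfaces the jumps agree with \<open>p\<close> and \<open>q\<close>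
  almost everywhere, which suffices for a complete measure.\<close>

lemma C1_inner_eq_pair_inner:
  assumes u: "has_grad_jump_upto M u p" and w: "has_grad_jump_upto M w q" and "M \<ge> 1"
  shows "C1_inner Q \<Gamma> C c M u w = pair_inner p q"
proof -
  have [measurable]: "fst p \<in> borel_measurable (lebesgue_on (cell_union M))"
    "fst q \<in> borel_measurable (lebesgue_on (cell_union M))"
    using u w by (auto simp: has_grad_jump_upto_def)
  have "(\<integral>x. grad u x \<bullet> grad w x \<partial>lebesgue_on (cell_union M)) =
      (\<integral>x. fst p x \<bullet> fst q x \<partial>lebesgue_on (cell_union M))"
    using u w by (intro Bochner_Integration.integral_cong) (auto simp: has_grad_jump_upto_def)
  also have "\<dots> = (\<integral>x. fst p x \<bullet> fst q x \<partial>lebesgue_on domain)"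
    by (rule integral_lebesgue_on_subset_negligible[OF cell_union_sets[OF \<open>M \<ge> 1\<close>] domain_subset
          negligible_cell_union_diff, symmetric]) measurable
  finally have grads: "(\<integral>x. grad u x \<bullet> grad w x \<partial>lebesgue_on (cell_union M)) = \<dots>" .
  have jumps: "(\<integral>\<xi>. jump u (\<Gamma> k) \<xi> * jump w (\<Gamma> k) \<xi> \<partial>surface k) = (\<integral>\<xi>. snd p k \<xi> * snd q k \<xi> \<partial>surface k)"
    if "k \<in> {1..M}" for k
  proof -
    have [measurable]: "snd p k \<in> borel_measurable (surface k)" "snd q k \<in> borel_measurable (surface k)"
      and "AE \<xi> in surface k. jump u (\<Gamma> k) \<xi> = snd p k \<xi>" "AE \<xi> in surface k. jump w (\<Gamma> k) \<xi> = snd q k \<xi>"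
      using u w that by (auto simp: has_grad_jump_upto_def)
    then have ae: "AE \<xi> in surface k. snd p k \<xi> * snd q k \<xi> = jump u (\<Gamma> k) \<xi> * jump w (\<Gamma> k) \<xi>"
      by auto
    have "(\<lambda>\<xi>. snd p k \<xi> * snd q k \<xi>) \<in> borel_measurable (surface k)" by measurable
    then show ?thesis
      using ae unfolding surface_measure_def by (rule completion.integral_cong_AE_complete)
  qed
  have "(\<Sum>k=1..M. (1 + c) ^ k * real (C k) * (\<integral>\<xi>. jump u (\<Gamma> k) \<xi> * jump w (\<Gamma> k) \<xi> \<partial>surface k)) =
      (\<Sum>k=1..M. weight k * (\<integral>\<xi>. snd p k \<xi> * snd q k \<xi> \<partial>surface k))"
    by (intro sum.cong) (simp_all add: jumps weight_def)
  also have "\<dots> = (\<Sum>k<M. weight (Suc k) * (\<integral>\<xi>. snd p (Suc k) \<xi> * snd q (Suc k) \<xi> \<partial>surface (Suc k)))"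
    by (simp add: sum.atLeast1_atMost_eq)
  also have "\<dots> = (\<Sum>k. weight (Suc k) * (\<integral>\<xi>. snd p (Suc k) \<xi> * snd q (Suc k) \<xi> \<partial>surface (Suc k)))"
  proof (rule suminf_finite[symmetric])
    fix k assume "k \<notin> {..<M}"
    then have "(\<integral>\<xi>. snd p (Suc k) \<xi> * snd q (Suc k) \<xi> \<partial>surface (Suc k)) = (\<integral>\<xi>. 0 \<partial>surface (Suc k))"
      using u by (intro Bochner_Integration.integral_cong) (auto simp: space_surface_measure has_grad_jump_upto_def)
    then show "weight (Suc k) * (\<integral>\<xi>. snd p (Suc k) \<xi> * snd q (Suc k) \<xi> \<partial>surface (Suc k)) = 0"
      by simp
  qed simp
  finally show ?thesis
    using grads by (simp add: C1_inner_def pair_inner_def)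
qed

lemma has_grad_jump_upto_grad_jump:
  assumes f: "f \<in> C1_space Q \<Gamma> L" and "1 \<le> L" "L \<le> M"
  shows "has_grad_jump_upto M f (grad_jump f)"
proof -
  have "grad f \<in> borel_measurable (lebesgue_on (cell_union L))"
    using f by (simp add: C1_space_def L2_space_def)
  then have "grad f \<in> borel_measurable (lebesgue_on (cell_union M))"
    using cell_union_antimono[OF \<open>L \<le> M\<close>] by (rule measurable_restrict_mono)
  then show ?thesis
    using C1_space_jump_L2[OF f] C1_space_jump_eq_0[OF f] \<open>L \<le> M\<close>
    by (simp add: has_grad_jump_upto_def grad_jump_def L2_space_def)
qed

text \<open>Gradients subtract on \<open>cell_union M\<close>, which lies in the cell unions of both
  levels. Jumps subtract wherever both one-sided limits exist, that is, almost everywhere on each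
  interface; beyond \<open>M\<close> both are 0.\<close>

lemma has_grad_jump_upto_diff:
  assumes f: "f \<in> C1_space Q \<Gamma> L" "1 \<le> L" "L \<le> M" and h: "h \<in> C1_space Q \<Gamma> K" "1 \<le> K" "K \<le> M"
  shows "has_grad_jump_upto M (\<lambda>x. f x - h x) (pair_lin (-1) (grad_jump f) (grad_jump h))"
proof -
  have grad: "grad (\<lambda>x. f x - h x) x = grad f x - grad h x" if "x \<in> cell_union M" for x
    using that cell_union_antimono[OF f(3)] cell_union_antimono[OF h(3)]
    by (intro grad_eqI GDERIV_diff C1_space_GDERIV[OF f(1)] C1_space_GDERIV[OF h(1)]) blast+
  have jump: "AE \<xi> in surface k. jump (\<lambda>x. f x - h x) (\<Gamma> k) \<xi> = jump f (\<Gamma> k) \<xi> - jump h (\<Gamma> k) \<xi>"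
    if "k \<ge> 1" for k
    using C1_space_jump_quotient_tendsto[OF f(1) that] C1_space_jump_quotient_tendsto[OF h(1) that]
  proof eventually_elim
    case (elim \<xi>)
    then have "((\<lambda>s. jump_quotient f (\<Gamma> k) \<xi> s - jump_quotient h (\<Gamma> k) \<xi> s) \<longlongrightarrow>
        jump f (\<Gamma> k) \<xi> - jump h (\<Gamma> k) \<xi>) (at_right 0)"
      by (rule tendsto_diff)
    moreover have "(\<lambda>s. jump_quotient f (\<Gamma> k) \<xi> s - jump_quotient h (\<Gamma> k) \<xi> s) =
        jump_quotient (\<lambda>x. f x - h x) (\<Gamma> k) \<xi>"
      by (simp add: jump_quotient_def fun_eq_iff)
    ultimately show ?case by (intro jump_eqI) simp
  qed
  have meas: "(\<lambda>x. grad f x - grad h x) \<in> borel_measurable (lebesgue_on (cell_union M))"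
    "\<forall>k\<in>{1..M}. (\<lambda>\<xi>. jump f (\<Gamma> k) \<xi> - jump h (\<Gamma> k) \<xi>) \<in> borel_measurable (surface k)"
    using has_grad_jump_upto_grad_jump[OF f] has_grad_jump_upto_grad_jump[OF h]
    by (auto simp: has_grad_jump_upto_def grad_jump_def intro!: borel_measurable_diff)
  show ?thesis
    using has_grad_jump_upto_grad_jump[OF f] has_grad_jump_upto_grad_jump[OF h] grad jump meas
    by (simp add: has_grad_jump_upto_def grad_jump_def pair_lin_def)
qed

lemma C1_inner_grad_jump:
  assumes "f \<in> C1_space Q \<Gamma> L" "1 \<le> L" "L \<le> M" "h \<in> C1_space Q \<Gamma> K" "1 \<le> K" "K \<le> M"
  shows "C1_inner Q \<Gamma> C c M f h = pair_inner (grad_jump f) (grad_jump h)"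
  by (rule C1_inner_eq_pair_inner[OF has_grad_jump_upto_grad_jump[OF assms(1-3)] has_grad_jump_upto_grad_jump[OF assms(4-6)]])
    (use assms in simp)

text \<open>The right-hand side is free of \<open>M\<close>: this is the isometric embedding of the
  levels, for functions of two levels at once.\<close>

lemma C1_dist_grad_jump:
  assumes "f \<in> C1_space Q \<Gamma> L" "1 \<le> L" "L \<le> M" "h \<in> C1_space Q \<Gamma> K" "1 \<le> K" "K \<le> M"
  shows "C1_dist Q \<Gamma> C c M f h = pairs.dst (grad_jump f) (grad_jump h)"
proof -
  have "has_grad_jump_upto M (\<lambda>x. f x - h x) (pair_lin (-1) (grad_jump f) (grad_jump h))"
    using assms by (rule has_grad_jump_upto_diff)
  moreover from this have "C1_inner Q \<Gamma> C c M (\<lambda>x. f x - h x) (\<lambda>x. f x - h x) =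
      pair_inner (pair_lin (-1) (grad_jump f) (grad_jump h)) (pair_lin (-1) (grad_jump f) (grad_jump h))"
    using assms by (intro C1_inner_eq_pair_inner) auto
  ultimately show ?thesis
    by (simp add: C1_dist_def pairs.dst_def)
qed

subsection \<open>Level spaces\<close>

lemma level_space_C1:
  "X \<in> level_space Q \<Gamma> C c K \<Longrightarrow> f \<in> X \<Longrightarrow> f n \<in> C1_space Q \<Gamma> K"
  unfolding level_space_def by (drule cauchy_completion_subset) (auto simp: cauchy_seqs_def)

lemma level_space_Cauchy_grad_jump:
  assumes "X \<in> level_space Q \<Gamma> C c K" "f \<in> X" "K \<ge> 1"
  shows "pairs.Cauchy_dst (\<lambda>n. grad_jump (f n))"
proof -
  have "f \<in> cauchy_seqs (C1_space Q \<Gamma> K) (C1_dist Q \<Gamma> C c K)"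
    using assms unfolding level_space_def by (blast intro: cauchy_completion_subset)
  moreover have "C1_dist Q \<Gamma> C c K (f m) (f n) = pairs.dst (grad_jump (f m)) (grad_jump (f n))" for m n
    by (rule C1_dist_grad_jump[where L = K and K = K]) (use level_space_C1[OF assms(1,2)] assms(3) in auto)
  ultimately show ?thesis
    using grad_jump_in[OF _ assms(3)] by (auto simp: cauchy_seqs_def pairs.Cauchy_dst_def)
qed

text \<open>Two members of a class are compared through the sequence \<open>x\<close> that generates
  it. This links the sequences chosen by \<open>extend_form\<close>, by the level gradient and by
  the level jump.\<close>

lemma level_space_equivalent:
  assumes X: "X \<in> level_space Q \<Gamma> C c K" "f \<in> X" "h \<in> X" and "K \<ge> 1"
  shows "(\<lambda>n. pairs.dst (grad_jump (f n)) (grad_jump (h n))) \<longlonglongrightarrow> 0"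
proof -
  obtain x where x: "x \<in> cauchy_seqs (C1_space Q \<Gamma> K) (C1_dist Q \<Gamma> C c K)"
    "X = {f \<in> cauchy_seqs (C1_space Q \<Gamma> K) (C1_dist Q \<Gamma> C c K). (\<lambda>n. C1_dist Q \<Gamma> C c K (x n) (f n)) \<longlonglongrightarrow> 0}"
    using X(1) unfolding level_space_def by (rule cauchy_completion_cases)
  have C1: "x n \<in> C1_space Q \<Gamma> K" "f n \<in> C1_space Q \<Gamma> K" "h n \<in> C1_space Q \<Gamma> K" for n
    using x(1) X(2,3) level_space_C1[OF X(1)] by (auto simp: cauchy_seqs_def)
  note tr = grad_jump_in[OF C1(1) \<open>K \<ge> 1\<close>] grad_jump_in[OF C1(2) \<open>K \<ge> 1\<close>] grad_jump_in[OF C1(3) \<open>K \<ge> 1\<close>]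
  have "(\<lambda>n. pairs.dst (grad_jump (x n)) (grad_jump (f n))) \<longlonglongrightarrow> 0" "(\<lambda>n. pairs.dst (grad_jump (x n)) (grad_jump (h n))) \<longlonglongrightarrow> 0"
    using X(2,3) x(2) C1_dist_grad_jump[OF C1(1) \<open>K \<ge> 1\<close> _ C1(2) \<open>K \<ge> 1\<close>]
      C1_dist_grad_jump[OF C1(1) \<open>K \<ge> 1\<close> _ C1(3) \<open>K \<ge> 1\<close>] by simp_all
  from tendsto_add[OF this]
  have lim: "(\<lambda>n. pairs.dst (grad_jump (x n)) (grad_jump (f n)) + pairs.dst (grad_jump (x n)) (grad_jump (h n))) \<longlonglongrightarrow> 0"
    by simp
  have "norm (pairs.dst (grad_jump (f n)) (grad_jump (h n))) \<le>
      pairs.dst (grad_jump (x n)) (grad_jump (f n)) + pairs.dst (grad_jump (x n)) (grad_jump (h n))" for n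
    using pairs.dst_triangle[OF tr(2) tr(1) tr(3), of n n n] pairs.dst_sym[OF tr(2) tr(1), of n n]
      pairs.dst_nonneg[OF tr(2) tr(3), of n n] by simp
  then show ?thesis by (intro Lim_null_comparison[OF always_eventually lim] allI)
qed

lemma level_space_representative:
  assumes "X \<in> level_space Q \<Gamma> C c K" "K \<ge> 1"
  shows "representative X \<in> X"
  using assms(1) unfolding level_space_def
proof (rule representative_in)
  show "C1_dist Q \<Gamma> C c K f f = 0" if "f \<in> C1_space Q \<Gamma> K" for f
    using C1_dist_grad_jump[OF that assms(2) order_refl that assms(2) order_refl]
      pairs.dst_self[OF grad_jump_in[OF that assms(2)]] by simp
qed

text \<open>\<open>extend_form\<close> is a \<open>lim\<close>, which is a genuine limit only if one
  exists. Existence follows because the chosen representatives are mapped to Cauchy sequences of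
  pairs.\<close>

lemma
  assumes X: "X \<in> level_space Q \<Gamma> C c L" "1 \<le> L" "L \<le> M"
    and Y: "Y \<in> level_space Q \<Gamma> C c K" "1 \<le> K" "K \<le> M"
  shows level_dist_tendsto:
      "(\<lambda>n. pairs.dst (grad_jump (representative X n)) (grad_jump (representative Y n))) \<longlonglongrightarrow> level_dist Q \<Gamma> C c M X Y"
    and level_inner_tendsto:
      "(\<lambda>n. pair_inner (grad_jump (representative X n)) (grad_jump (representative Y n))) \<longlonglongrightarrow> level_inner Q \<Gamma> C c M X Y"
proof -
  note r = level_space_representative[OF X(1,2)] level_space_representative[OF Y(1,2)]
  note C1 = level_space_C1[OF X(1) r(1)] level_space_C1[OF Y(1) r(2)]
  note Cauchy = level_space_Cauchy_grad_jump[OF X(1) r(1) X(2)] level_space_Cauchy_grad_jump[OF Y(1) r(2) Y(2)]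
  show "(\<lambda>n. pairs.dst (grad_jump (representative X n)) (grad_jump (representative Y n))) \<longlonglongrightarrow> level_dist Q \<Gamma> C c M X Y"
    using pairs.convergent_dst[OF Cauchy]
    by (simp add: level_dist_def extend_form_def C1_dist_grad_jump[OF C1(1) X(2,3) C1(2) Y(2,3)]
        convergent_LIMSEQ_iff flip: representative_def)
  show "(\<lambda>n. pair_inner (grad_jump (representative X n)) (grad_jump (representative Y n))) \<longlonglongrightarrow> level_inner Q \<Gamma> C c M X Y"
    using pairs.convergent_B[OF Cauchy]
    by (simp add: level_inner_def extend_form_def C1_inner_grad_jump[OF C1(1) X(2,3) C1(2) Y(2,3)]
        convergent_LIMSEQ_iff flip: representative_def)
qed

section \<open>Gradient and jump of a level element as a limit of pairs\<close>

lemma pairs_dst_same_jump: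
  "(g, i) \<in> pair_space \<Longrightarrow> (h, i) \<in> pair_space \<Longrightarrow>
    pairs.dst (g, i) (h, i) = L2_norm (lebesgue_on domain) (\<lambda>x. g x - h x)"
  by (rule power2_eq_imp_eq)
    (simp_all add: pairs_dst_power2 pairs.dst_nonneg L2_norm_nonneg jump_norm_def L2_norm_def)

lemma jump_norm_nonneg:
  assumes "i \<in> jump_space \<Gamma> C c" "j \<in> jump_space \<Gamma> C c"
  shows "jump_norm \<Gamma> C c (\<lambda>k \<xi>. i k \<xi> - j k \<xi>) \<ge> 0"
proof -
  have "(\<lambda>k \<xi>. i k \<xi> + (-1) * j k \<xi>) \<in> jump_space \<Gamma> C c"
    using assms by (rule jump_space_lin)
  then have "summable (\<lambda>k. weight (Suc k) * (L2_norm (surface (Suc k)) (\<lambda>\<xi>. i (Suc k) \<xi> - j (Suc k) \<xi>))\<^sup>2)"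
    by (simp add: jump_space_iff L2_norm_power2)
  then show ?thesis
    unfolding jump_norm_def weight_def[symmetric]
    by (intro real_sqrt_ge_zero suminf_nonneg mult_nonneg_nonneg weight_nonneg) auto
qed

lemma pairs_dst_same_gradient:
  assumes "(g, i) \<in> pair_space" "(g, j) \<in> pair_space"
  shows "pairs.dst (g, i) (g, j) = jump_norm \<Gamma> C c (\<lambda>k \<xi>. i k \<xi> - j k \<xi>)"
proof (rule power2_eq_imp_eq)
  show "0 \<le> jump_norm \<Gamma> C c (\<lambda>k \<xi>. i k \<xi> - j k \<xi>)"
    using assms by (intro jump_norm_nonneg) (auto simp: pair_space_def)
qed (use assms in \<open>simp_all add: pairs_dst_power2 pairs.dst_nonneg L2_norm_def\<close>)

text \<open>The gradient is given as a limit along one member \<open>f1\<close> of the class, the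
  jump along another member \<open>f2\<close>, while \<open>f\<close> is a third. The path from
  \<open>f\<close> to the limit leads through \<open>f2\<close>, then exchanges the gradient for
  that of \<open>f1\<close>, then for \<open>g\<close>, and finally the jump for
  \<open>j\<close>.\<close>

lemma level_space_grad_jump_tendsto:
  assumes X: "X \<in> level_space Q \<Gamma> C c K" "f \<in> X" and "K \<ge> 1"
    and g: "level_gradient Q \<Gamma> K X g" and j: "level_jump \<Gamma> C c X j"
  shows "(g, j) \<in> pair_space" and "(\<lambda>n. pairs.dst (grad_jump (f n)) (g, j)) \<longlonglongrightarrow> 0"
proof -
  note sub = cell_union_sets[OF \<open>K \<ge> 1\<close>] domain_subset negligible_cell_union_diff
  have gL2: "g \<in> L2_space (lebesgue_on (cell_union K))" using g by (simp add: level_gradient_def)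
  with j show gj: "(g, j) \<in> pair_space"
    using L2_space_lebesgue_on_subset[OF sub] by (simp add: pair_space_def level_jump_def)
  obtain f1 where f1: "f1 \<in> X" "(\<lambda>n. L2_norm (lebesgue_on (cell_union K)) (\<lambda>x. grad (f1 n) x - g x)) \<longlonglongrightarrow> 0"
    using g by (auto simp: level_gradient_def)
  obtain f2 where f2: "f2 \<in> X" "(\<lambda>n. jump_norm \<Gamma> C c (\<lambda>k \<xi>. jump (f2 n) (\<Gamma> k) \<xi> - j k \<xi>)) \<longlonglongrightarrow> 0"
    using j by (auto simp: level_jump_def)
  note C1 = level_space_C1[OF X(1)]
  note tr = grad_jump_in[OF C1 \<open>K \<ge> 1\<close>]
  \<comment> \<open>These pairs need not come from any function; \<open>pair_space\<close> is a
    product, so they are admissible intermediate points.\<close>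
  have mixed: "(grad (f1 n), \<lambda>k. jump (f2 n) (\<Gamma> k)) \<in> pair_space" "(g, \<lambda>k. jump (f2 n) (\<Gamma> k)) \<in> pair_space" for n
    using tr[OF f1(1), of n] tr[OF f2(1), of n] gj by (auto simp: grad_jump_def pair_space_def)
  have "L2_norm (lebesgue_on domain) (\<lambda>x. grad (f1 n) x - g x) = L2_norm (lebesgue_on (cell_union K)) (\<lambda>x. grad (f1 n) x - g x)" for n
  proof -
    have [measurable]: "grad (f1 n) \<in> borel_measurable (lebesgue_on (cell_union K))"
        "g \<in> borel_measurable (lebesgue_on (cell_union K))"
      using C1[OF f1(1), of n] gL2 by (auto simp: C1_space_def L2_space_def)
    have "(\<lambda>x. (norm (grad (f1 n) x - g x))\<^sup>2) \<in> borel_measurable (lebesgue_on (cell_union K))"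
      by measurable
    then show ?thesis
      unfolding L2_norm_def by (subst integral_lebesgue_on_subset_negligible[OF sub]) auto
  qed
  then have lim1: "(\<lambda>n. L2_norm (lebesgue_on domain) (\<lambda>x. grad (f1 n) x - g x)) \<longlonglongrightarrow> 0"
    using f1(2) by simp
  let ?d = "\<lambda>n. pairs.dst (grad_jump (f n)) (grad_jump (f2 n)) + (pairs.dst (grad_jump (f2 n)) (grad_jump (f1 n)) +
      (L2_norm (lebesgue_on domain) (\<lambda>x. grad (f1 n) x - g x) +
       jump_norm \<Gamma> C c (\<lambda>k \<xi>. jump (f2 n) (\<Gamma> k) \<xi> - j k \<xi>)))"
  have "?d \<longlonglongrightarrow> 0 + (0 + (0 + 0))"
    by (intro tendsto_add lim1 f2(2) level_space_equivalent[OF X(1)] X(2) f1(1) f2(1) \<open>K \<ge> 1\<close>)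
  then have lim: "?d \<longlonglongrightarrow> 0" by simp
  have "norm (pairs.dst (grad_jump (f n)) (g, j)) \<le> ?d n" for n
  proof -
    let ?m = "(grad (f1 n), \<lambda>k. jump (f2 n) (\<Gamma> k))" and ?m' = "(g, \<lambda>k. jump (f2 n) (\<Gamma> k))"
    have t2: "grad_jump (f2 n) = (grad (f2 n), \<lambda>k. jump (f2 n) (\<Gamma> k))" by (simp add: grad_jump_def)
    \<comment> \<open>Exchanging only the gradient costs no more than exchanging the whole pair, by
      Pythagoras.\<close>
    have "pairs.dst (grad_jump (f2 n)) ?m \<le> pairs.dst (grad_jump (f2 n)) (grad_jump (f1 n))"
    proof (rule power2_le_imp_le)
      show "(pairs.dst (grad_jump (f2 n)) ?m)\<^sup>2 \<le> (pairs.dst (grad_jump (f2 n)) (grad_jump (f1 n)))\<^sup>2"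
        using tr[OF f1(1), of n] tr[OF f2(1), of n] mixed(1)[of n]
        by (simp add: pairs_dst_same_jump t2) (simp add: grad_jump_def pairs_dst_power2)
    qed (simp add: pairs.dst_nonneg tr f1(1) f2(1))
    moreover have "pairs.dst ?m ?m' = L2_norm (lebesgue_on domain) (\<lambda>x. grad (f1 n) x - g x)"
      by (rule pairs_dst_same_jump[OF mixed])
    moreover have "pairs.dst ?m' (g, j) = jump_norm \<Gamma> C c (\<lambda>k \<xi>. jump (f2 n) (\<Gamma> k) \<xi> - j k \<xi>)"
      by (rule pairs_dst_same_gradient[OF mixed(2) gj])
    moreover have "pairs.dst (grad_jump (f n)) (g, j) \<le> pairs.dst (grad_jump (f n)) (grad_jump (f2 n)) +
        (pairs.dst (grad_jump (f2 n)) ?m + (pairs.dst ?m ?m' + pairs.dst ?m' (g, j)))"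
      using pairs.dst_triangle[OF tr[OF X(2)] tr[OF f2(1)] gj, of n n]
        pairs.dst_triangle[OF tr[OF f2(1)] mixed(1) gj, of n n]
        pairs.dst_triangle[OF mixed(1) mixed(2) gj, of n n] by linarith
    moreover have "pairs.dst (grad_jump (f n)) (g, j) \<ge> 0"
      by (rule pairs.dst_nonneg[OF tr[OF X(2)] gj])
    ultimately show ?thesis by simp
  qed
  then show "(\<lambda>n. pairs.dst (grad_jump (f n)) (g, j)) \<longlonglongrightarrow> 0"
    by (intro Lim_null_comparison[OF always_eventually lim] allI)
qed

subsection \<open>The union of the level spaces and its completion\<close>

definition approximant :: "nat \<times> 'n level_elem \<Rightarrow> nat \<Rightarrow> ('n vector \<Rightarrow> 'n vector) \<times> (nat \<Rightarrow> 'n vector \<Rightarrow> real)" where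
  "approximant x n = grad_jump (representative (snd x) n)"

lemma approximant_in:
  assumes "x \<in> union_space Q \<Gamma> C c"
  shows "approximant x n \<in> pair_space"
  using assms grad_jump_in level_space_C1 level_space_representative
  unfolding approximant_def union_space_def by fastforce

lemma
  assumes "x \<in> union_space Q \<Gamma> C c" "y \<in> union_space Q \<Gamma> C c"
  shows union_dist_tendsto: "(\<lambda>n. pairs.dst (approximant x n) (approximant y n)) \<longlonglongrightarrow> union_dist Q \<Gamma> C c x y"
    and union_inner_tendsto: "(\<lambda>n. pair_inner (approximant x n) (approximant y n)) \<longlonglongrightarrow> union_inner Q \<Gamma> C c x y"
  using assms
  by (auto simp: union_space_def union_dist_def union_inner_def approximant_def
      intro!: level_dist_tendsto level_inner_tendsto)

lemma union_dist_self:
  assumes "x \<in> union_space Q \<Gamma> C c"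
  shows "union_dist Q \<Gamma> C c x x = 0"
  using union_dist_tendsto[OF assms assms] pairs.dst_self[OF approximant_in[OF assms]]
  by (simp add: LIMSEQ_const_iff)

lemma fractal_space_representative:
  "X \<in> fractal_space Q \<Gamma> C c \<Longrightarrow> representative X \<in> X"
  unfolding fractal_space_def by (erule representative_in) (rule union_dist_self)

lemma fractal_space_union_space:
  "X \<in> fractal_space Q \<Gamma> C c \<Longrightarrow> f \<in> X \<Longrightarrow> f n \<in> union_space Q \<Gamma> C c"
  unfolding fractal_space_def by (drule cauchy_completion_subset) (auto simp: cauchy_seqs_def)

text \<open>The sequence \<open>f\<close> may run through the levels in any order, so
  \<open>f n\<close> is compared with \<open>v (Suc n)\<close> through the generator
  \<open>x\<close> of the class, and \<open>v (Suc n)\<close> with its own gradient and jump. Each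
  comparison with \<open>approximant\<close> is a limit in the inner index; the bound
  \<open>e n\<close> is uniform for all large inner indices, which leaves them free for a diagonal
  choice.\<close>

lemma fractal_space_approximant:
  assumes X: "X \<in> fractal_space Q \<Gamma> C c" "f \<in> X" and v: "represented_by X v"
    and g: "weak_gradient Q \<Gamma> v g" and j: "generalized_jump \<Gamma> C c v j"
  obtains e where "e \<longlonglongrightarrow> 0" "\<And>n. \<forall>\<^sub>F m in sequentially. pairs.dst (approximant (f n) m) (g, j) < e n"
proof -
  \<comment> \<open>\<open>represented_by\<close> starts at level 1, hence the shift by one.\<close>
  define a where "a n = (Suc n, v (Suc n))" for n
  have aX: "a \<in> X" using v by (simp add: represented_by_def a_def[abs_def])
  obtain x where x: "x \<in> cauchy_seqs (union_space Q \<Gamma> C c) (union_dist Q \<Gamma> C c)"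
    "X = {f \<in> cauchy_seqs (union_space Q \<Gamma> C c) (union_dist Q \<Gamma> C c). (\<lambda>n. union_dist Q \<Gamma> C c (x n) (f n)) \<longlonglongrightarrow> 0}"
    using X(1) unfolding fractal_space_def by (rule cauchy_completion_cases)
  have U: "x n \<in> union_space Q \<Gamma> C c" "f n \<in> union_space Q \<Gamma> C c" "a n \<in> union_space Q \<Gamma> C c" for n
    using x(1) fractal_space_union_space[OF X(1)] X(2) aX by (auto simp: cauchy_seqs_def)
  obtain gK where gK: "\<And>K. K \<ge> 1 \<Longrightarrow> level_gradient Q \<Gamma> K (v K) (gK K)"
    "(\<lambda>K. L2_norm (lebesgue_on domain) (\<lambda>x. gK K x - g x)) \<longlonglongrightarrow> 0"
    using g by (auto simp: weak_gradient_def)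
  obtain jK where jK: "\<And>K. K \<ge> 1 \<Longrightarrow> level_jump \<Gamma> C c (v K) (jK K)"
    "(\<lambda>K. jump_norm \<Gamma> C c (\<lambda>k \<xi>. jK K k \<xi> - j k \<xi>)) \<longlonglongrightarrow> 0"
    using j by (auto simp: generalized_jump_def)
  have gj: "(g, j) \<in> pair_space"
    using g j by (simp add: weak_gradient_def generalized_jump_def pair_space_def)
  define q where "q n = (gK (Suc n), jK (Suc n))" for n
  have lev: "v (Suc n) \<in> level_space Q \<Gamma> C c (Suc n)" for n
    using U(3)[of n] by (simp add: a_def union_space_def)
  have q: "q n \<in> pair_space" "(\<lambda>m. pairs.dst (approximant (a n) m) (q n)) \<longlonglongrightarrow> 0" for n
    using level_space_grad_jump_tendsto[OF lev level_space_representative[OF lev] _ gK(1) jK(1), of n]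
    by (simp_all add: q_def a_def approximant_def)
  have q_lim: "(\<lambda>n. pairs.dst (q n) (g, j)) \<longlonglongrightarrow> 0"
  proof -
    have mixed: "(g, jK (Suc n)) \<in> pair_space" for n
      using q(1)[of n] gj by (simp add: q_def pair_space_def)
    have "pairs.dst (q n) (g, jK (Suc n)) = L2_norm (lebesgue_on domain) (\<lambda>x. gK (Suc n) x - g x)" for n
      using q(1)[of n] mixed[of n] unfolding q_def by (rule pairs_dst_same_jump)
    moreover have "pairs.dst (g, jK (Suc n)) (g, j) = jump_norm \<Gamma> C c (\<lambda>k \<xi>. jK (Suc n) k \<xi> - j k \<xi>)" for n
      by (rule pairs_dst_same_gradient[OF mixed gj])
    ultimately have le: "norm (pairs.dst (q n) (g, j)) \<le> L2_norm (lebesgue_on domain) (\<lambda>x. gK (Suc n) x - g x) +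
        jump_norm \<Gamma> C c (\<lambda>k \<xi>. jK (Suc n) k \<xi> - j k \<xi>)" for n
      using pairs.dst_triangle[OF q(1) mixed gj, of n n] pairs.dst_nonneg[OF q(1) gj, of n] by simp
    have "(\<lambda>n. L2_norm (lebesgue_on domain) (\<lambda>x. gK (Suc n) x - g x) +
        jump_norm \<Gamma> C c (\<lambda>k \<xi>. jK (Suc n) k \<xi> - j k \<xi>)) \<longlonglongrightarrow> 0"
      using tendsto_add[OF gK(2) jK(2), THEN LIMSEQ_Suc] by simp
    then show ?thesis by (rule Lim_null_comparison[OF always_eventually[OF allI[OF le]]])
  qed
  let ?e = "\<lambda>n. union_dist Q \<Gamma> C c (x n) (f n) + (union_dist Q \<Gamma> C c (x n) (a n) + pairs.dst (q n) (g, j))"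
  have "(\<lambda>n. union_dist Q \<Gamma> C c (x n) (f n)) \<longlonglongrightarrow> 0" "(\<lambda>n. union_dist Q \<Gamma> C c (x n) (a n)) \<longlonglongrightarrow> 0"
    using X(2) aX x(2) by auto
  \<comment> \<open>The inner limit is exactly \<open>?e n\<close>; a positive null sequence is
    added to get a strict bound that holds eventually.\<close>
  then have "(\<lambda>n. ?e n + inverse (real (Suc n))) \<longlonglongrightarrow> 0 + (0 + 0) + 0"
    by (intro tendsto_add q_lim LIMSEQ_inverse_real_of_nat)
  then have e_lim: "(\<lambda>n. ?e n + inverse (real (Suc n))) \<longlonglongrightarrow> 0" by simp
  moreover have "\<forall>\<^sub>F m in sequentially. pairs.dst (approximant (f n) m) (g, j) < ?e n + inverse (real (Suc n))" for n
  proof -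
    let ?d = "\<lambda>m. pairs.dst (approximant (x n) m) (approximant (f n) m) +
        (pairs.dst (approximant (x n) m) (approximant (a n) m) +
         (pairs.dst (approximant (a n) m) (q n) + pairs.dst (q n) (g, j)))"
    have "?d \<longlonglongrightarrow> union_dist Q \<Gamma> C c (x n) (f n) + (union_dist Q \<Gamma> C c (x n) (a n) + (0 + pairs.dst (q n) (g, j)))"
      by (intro tendsto_add union_dist_tendsto U q(2) tendsto_const)
    then have "\<forall>\<^sub>F m in sequentially. ?d m < ?e n + inverse (real (Suc n))"
      by (rule order_tendstoD) simp
    then show ?thesis
    proof eventually_elim
      case (elim m)
      note A = approximant_in[OF U(1), of n m] approximant_in[OF U(2), of n m] approximant_in[OF U(3), of n m]
      have "pairs.dst (approximant (f n) m) (g, j) \<le> ?d m"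
        using pairs.dst_triangle[OF A(2) A(1) gj] pairs.dst_triangle[OF A(1) A(3) gj]
          pairs.dst_triangle[OF A(3) q(1) gj, of n] pairs.dst_sym[OF A(2) A(1)] by linarith
      with elim show ?case by linarith
    qed
  qed
  ultimately show ?thesis by (rule that)
qed

lemma fractal_inner_eq_pair_inner:
  assumes X: "X \<in> fractal_space Q \<Gamma> C c" "represented_by X v" "weak_gradient Q \<Gamma> v g" "generalized_jump \<Gamma> C c v i"
    and Y: "Y \<in> fractal_space Q \<Gamma> C c" "represented_by Y w" "weak_gradient Q \<Gamma> w h" "generalized_jump \<Gamma> C c w j"
  shows "fractal_inner Q \<Gamma> C c X Y = pair_inner (g, i) (h, j)"
proof -
  let ?x = "representative X" and ?y = "representative Y"
  note r = fractal_space_representative[OF X(1)] fractal_space_representative[OF Y(1)]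
  note U = fractal_space_union_space[OF X(1) r(1)] fractal_space_union_space[OF Y(1) r(2)]
  obtain e where e: "e \<longlonglongrightarrow> 0" "\<And>n. \<forall>\<^sub>F m in sequentially. pairs.dst (approximant (?x n) m) (g, i) < e n"
    by (rule fractal_space_approximant[OF X(1) r(1) X(2-4)]) blast
  obtain e' where e': "e' \<longlonglongrightarrow> 0" "\<And>n. \<forall>\<^sub>F m in sequentially. pairs.dst (approximant (?y n) m) (h, j) < e' n"
    by (rule fractal_space_approximant[OF Y(1) r(2) Y(2-4)]) blast
  have "\<forall>\<^sub>F m in sequentially. \<bar>pair_inner (approximant (?x n) m) (approximant (?y n) m) - union_inner Q \<Gamma> C c (?x n) (?y n)\<bar>
      < inverse (real (Suc n))" for n
    using tendstoD[OF union_inner_tendsto[OF U(1) U(2), of n n], of "inverse (real (Suc n))"]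
    by (simp add: dist_real_def)
  \<comment> \<open>One inner index has to serve three purposes: both approximants are close to
    their target pairs, and their inner product is close to \<open>union_inner\<close>. Only the
    last ties the diagonal sequence to \<open>fractal_inner\<close>.\<close>
  then have "\<exists>m. pairs.dst (approximant (?x n) m) (g, i) < e n \<and> pairs.dst (approximant (?y n) m) (h, j) < e' n \<and>
      \<bar>pair_inner (approximant (?x n) m) (approximant (?y n) m) - union_inner Q \<Gamma> C c (?x n) (?y n)\<bar>
      < inverse (real (Suc n))" for n
    using e(2)[of n] e'(2)[of n] by (intro eventually_happens' eventually_conj) auto
  then obtain m where m: "\<And>n. pairs.dst (approximant (?x n) (m n)) (g, i) < e n"
    "\<And>n. pairs.dst (approximant (?y n) (m n)) (h, j) < e' n"
    "\<And>n. \<bar>pair_inner (approximant (?x n) (m n)) (approximant (?y n) (m n)) - union_inner Q \<Gamma> C c (?x n) (?y n)\<bar>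
      < inverse (real (Suc n))"
    by metis
  note A = approximant_in[OF U(1)] approximant_in[OF U(2)]
  have P: "(g, i) \<in> pair_space" "(h, j) \<in> pair_space"
    using X(3,4) Y(3,4) by (auto simp: weak_gradient_def generalized_jump_def pair_space_def)
  have "norm (pairs.dst (approximant (?x n) (m n)) (g, i)) \<le> e n" for n
    using m(1)[of n] pairs.dst_nonneg[OF A(1) P(1), of n "m n"] by simp
  then have limx: "(\<lambda>n. pairs.dst (approximant (?x n) (m n)) (g, i)) \<longlonglongrightarrow> 0"
    by (intro Lim_null_comparison[OF always_eventually e(1)] allI)
  have "norm (pairs.dst (approximant (?y n) (m n)) (h, j)) \<le> e' n" for n
    using m(2)[of n] pairs.dst_nonneg[OF A(2) P(2), of n "m n"] by simp
  then have limy: "(\<lambda>n. pairs.dst (approximant (?y n) (m n)) (h, j)) \<longlonglongrightarrow> 0"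
    by (intro Lim_null_comparison[OF always_eventually e'(1)] allI)
  have "(\<lambda>n. pair_inner (approximant (?x n) (m n)) (approximant (?y n) (m n))) \<longlonglongrightarrow> pair_inner (g, i) (h, j)"
    by (rule pairs.B_tendsto[OF A P limx limy])
  moreover have "(\<lambda>n. pair_inner (approximant (?x n) (m n)) (approximant (?y n) (m n)) - union_inner Q \<Gamma> C c (?x n) (?y n)) \<longlonglongrightarrow> 0"
    by (rule Lim_null_comparison[OF always_eventually LIMSEQ_inverse_real_of_nat]) (use m(3) less_imp_le in auto)
  \<comment> \<open>This includes the convergence of the sequence behind
    \<open>fractal_inner\<close>, so that its \<open>lim\<close> is this value.\<close>
  ultimately have "(\<lambda>n. union_inner Q \<Gamma> C c (?x n) (?y n)) \<longlonglongrightarrow> pair_inner (g, i) (h, j)"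
    using tendsto_diff by fastforce
  then show ?thesis
    by (simp add: fractal_inner_def extend_form_def limI flip: representative_def)
qed

end

theorem theorem3p10:
  fixes Q :: "'n::{finite,linorder} vector set"
    and \<Gamma> :: "nat \<Rightarrow> 'n vector set"
    and C :: "nat \<Rightarrow> nat"
    and c :: real
    and v\<^sub>H w\<^sub>H :: "'n fractal_elem"
    and v\<^sub>K w\<^sub>K :: "nat \<Rightarrow> 'n level_elem"
    and v w :: "'n vector \<Rightarrow> real"
    and grad_v grad_w :: "'n vector \<Rightarrow> 'n vector"
    and jump_v jump_w :: "nat \<Rightarrow> 'n vector \<Rightarrow> real"
  assumes "multiscale_network Q \<Gamma> C"
    and "c > 0"
    and "v\<^sub>H \<in> fractal_space Q \<Gamma> C c" and "represented_by v\<^sub>H v\<^sub>K"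
    and "w\<^sub>H \<in> fractal_space Q \<Gamma> C c" and "represented_by w\<^sub>H w\<^sub>K"
    and "associated_function Q v\<^sub>K v" and "associated_function Q w\<^sub>K w"
    and "weak_gradient Q \<Gamma> v\<^sub>K grad_v" and "weak_gradient Q \<Gamma> w\<^sub>K grad_w"
    and "generalized_jump \<Gamma> C c v\<^sub>K jump_v" and "generalized_jump \<Gamma> C c w\<^sub>K jump_w"
  shows "fractal_inner Q \<Gamma> C c v\<^sub>H w\<^sub>H =
    (\<integral>x. grad_v x \<bullet> grad_w x \<partial>lebesgue_on (Q - all_interfaces \<Gamma>)) +
    (\<Sum>k. (1 + c) ^ Suc k * real (C (Suc k)) *
       (\<integral>\<xi>. jump_v (Suc k) \<xi> * jump_w (Suc k) \<xi> \<partial>surface_measure (\<Gamma> (Suc k))))"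
proof -
  interpret interface_network Q \<Gamma> C c
    using assms(1,2) by unfold_locales
  show ?thesis
    using fractal_inner_eq_pair_inner[OF assms(3,4,9,11) assms(5,6,10,12)]
    by (simp add: pair_inner_def weight_def)
qed

end
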